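(* Let $0\ne p\in\mathbb C[z,w]$. The space $\mathscr E_z$ reduces $\mathbf C_p^2$, and $$\mathbf C_p^2|_{\mathscr E_z}=Q_zQ_wQ_z|_{\mathscr E_z}=\Gamma_p^*\Gamma_p .$$ If $(e_i)$ and $(f_j)$ are arbitrary orthonormal bases of $\mathscr E_z$ and $\mathscr E_w$, respectively, then the matrix of $\Gamma_p$ is the bivariate cross-Gram matrix $\big(\langle e_i,f_j\rangle_{\nu_p}\big)_{j,i}$. Assume, in particular, that $\mathbf C_p$ is compact. If $s\in(0,1)$ is a singular value of $\Gamma_p$ of multiplicity $m$, then $s$ and $-s$ are eigenvalues of $\mathbf C_p$, each of multiplicity $m$. The endpoint eigenspaces are $$\ker(\mathbf C_p-I)=\mathscr H_p\ominus(z\mathscr H_p+w\mathscr H_p),$$ $$\ker(\mathbf C_p+I)=(z\mathscr H_p\cap w\mathscr H_p)\ominus zw\mathscr H_p .$$ Consequently, the complete non-zero core spectrum (that is, the non-zero spectrum of $\mathbf C_p$) is determined by $\Gamma_p$ together with the two endpoint spaces.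
   Context: Let $\sigma$ be normalized Haar measure on $\mathbb T^2$ and $\|p\|_2$ the norm of $p$ in $L^2(\mathbb T^2,\sigma)$. Put $d\nu_p=\frac{|p|^2}{\|p\|_2^2}d\sigma$ and let $\mathscr H_p=P^2(\nu_p)$ be the closure of $\mathbb C[z,w]$ in $L^2(\nu_p)$, with inner product $\langle\cdot,\cdot\rangle_{\nu_p}$ linear in the first variable. $S_z,S_w$ are multiplication by $z,w$ on $\mathscr H_p$ (commuting isometries). $\mathscr E_z=\mathscr H_p\ominus z\mathscr H_p$ and $\mathscr E_w=\mathscr H_p\ominus w\mathscr H_p$, with $Q_z,Q_w$ the orthogonal projections of $\mathscr H_p$ onto them. Define the core operator of this weighted model and the edge cross-Gram operator by $$\mathbf C_p=I-S_zS_z^*-S_wS_w^*+S_zS_wS_z^*S_w^*,\qquad \Gamma_p=Q_w|_{\mathscr E_z}:\mathscr E_z\to\mathscr E_w .$$ The operator $\mathbf C_p$ is unitarily equivalent to the core operator $I-R_zR_z^*-R_wR_w^*+R_zR_wR_z^*R_w^*$ of the principal submodule $[p]$, the closure of $p\,\mathbb C[z,w]$ in the Hardy space $H^2(\mathbb D^2)$, where $R_z,R_w$ are the restrictions to $[p]$ of multiplication by $z,w$. *)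

theory Defs
  imports "HOL-Probability.Probability" "HOL-Computational_Algebra.Computational_Algebra"
begin

section \<open>Operators on subspaces of a complex inner product space\<close>

class complex_vector = ab_group_add +
  fixes scaleC :: "complex \<Rightarrow> 'a \<Rightarrow> 'a" (infixr "*\<^sub>C" 75)
  assumes scaleC_add_right: "c *\<^sub>C (x + y) = c *\<^sub>C x + c *\<^sub>C y"
    and scaleC_add_left: "(c + d) *\<^sub>C x = c *\<^sub>C x + d *\<^sub>C x"
    and scaleC_scaleC: "c *\<^sub>C d *\<^sub>C x = (c * d) *\<^sub>C x"
    and scaleC_one: "1 *\<^sub>C x = x"

global_interpretation complex_vector: vector_space "scaleC :: complex \<Rightarrow> 'a \<Rightarrow> 'a :: complex_vector"
  by unfold_locales (simp_all add: scaleC_add_right scaleC_add_left scaleC_scaleC scaleC_one)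

text \<open>
  A Hilbert space is given by a set \<open>H\<close> of vectors together with an inner product \<open>ip\<close>
  (linear in the first variable) that is only meaningful on \<open>H\<close>; several inner products may
  live on the same type. Operators are functions on the whole type of which only the values on
  the domain set matter.
\<close>

type_synonym 'v inner_prod = "'v \<Rightarrow> 'v \<Rightarrow> complex"

definition ip_norm :: "'v inner_prod \<Rightarrow> 'v \<Rightarrow> real" where
  "ip_norm ip x = sqrt (cmod (ip x x))"

definition ip_dist :: "'v::ab_group_add inner_prod \<Rightarrow> 'v \<Rightarrow> 'v \<Rightarrow> real" where
  "ip_dist ip x y = ip_norm ip (x - y)"

definition ip_topology :: "'v::ab_group_add inner_prod \<Rightarrow> 'v set \<Rightarrow> 'v topology" where
  "ip_topology ip H = Metric_space.mtopology H (ip_dist ip)"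

definition ortho_minus :: "'v inner_prod \<Rightarrow> 'v set \<Rightarrow> 'v set \<Rightarrow> 'v set" where
  "ortho_minus ip H W = {x \<in> H. \<forall>y\<in>W. ip x y = 0}"

definition ortho_proj :: "'v::ab_group_add inner_prod \<Rightarrow> 'v set \<Rightarrow> 'v \<Rightarrow> 'v" where
  "ortho_proj ip W x = (THE y. y \<in> W \<and> (\<forall>w\<in>W. ip (x - y) w = 0))"

text \<open>The adjoint of an operator with domain \<open>V\<close>; the codomain plays no role in the defining
  equation.\<close>

definition adjoint_on :: "'v inner_prod \<Rightarrow> 'v set \<Rightarrow> ('v \<Rightarrow> 'v) \<Rightarrow> 'v \<Rightarrow> 'v" where
  "adjoint_on ip V T y = (THE x. x \<in> V \<and> (\<forall>v\<in>V. ip (T v) y = ip v x))"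

definition closed_subspace :: "'v::complex_vector inner_prod \<Rightarrow> 'v set \<Rightarrow> 'v set \<Rightarrow> bool" where
  "closed_subspace ip H W \<longleftrightarrow>
     W \<subseteq> H \<and> complex_vector.subspace W \<and> closedin (ip_topology ip H) W"

definition reduces :: "'v::complex_vector inner_prod \<Rightarrow> 'v set \<Rightarrow> ('v \<Rightarrow> 'v) \<Rightarrow> 'v set \<Rightarrow> bool" where
  "reduces ip H T W \<longleftrightarrow> closed_subspace ip H W \<and> T ` W \<subseteq> W \<and>
     T ` ortho_minus ip H W \<subseteq> ortho_minus ip H W"

definition bounded_op :: "'v::complex_vector inner_prod \<Rightarrow> 'v set \<Rightarrow> ('v \<Rightarrow> 'v) \<Rightarrow> bool" where
  "bounded_op ip H T \<longleftrightarrow> T ` H \<subseteq> H \<and>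
     (\<forall>x\<in>H. \<forall>y\<in>H. T (x + y) = T x + T y) \<and>
     (\<forall>c. \<forall>x\<in>H. T (c *\<^sub>C x) = c *\<^sub>C T x) \<and>
     (\<exists>K. \<forall>x\<in>H. ip_norm ip (T x) \<le> K * ip_norm ip x)"

definition compact_op :: "'v::complex_vector inner_prod \<Rightarrow> 'v set \<Rightarrow> ('v \<Rightarrow> 'v) \<Rightarrow> bool" where
  "compact_op ip H T \<longleftrightarrow> bounded_op ip H T \<and>
     compactin (ip_topology ip H)
       (ip_topology ip H closure_of (T ` {x \<in> H. ip_norm ip x \<le> 1}))"

definition op_spectrum :: "'v::complex_vector inner_prod \<Rightarrow> 'v set \<Rightarrow> ('v \<Rightarrow> 'v) \<Rightarrow> complex set" where
  "op_spectrum ip H T = {\<mu>. \<not> (\<exists>R. bounded_op ip H R \<and>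
     (\<forall>x\<in>H. R (T x - \<mu> *\<^sub>C x) = x \<and> T (R x) - \<mu> *\<^sub>C R x = x))}"

definition eigenspace :: "'v::complex_vector set \<Rightarrow> ('v \<Rightarrow> 'v) \<Rightarrow> complex \<Rightarrow> 'v set" where
  "eigenspace H T \<mu> = {x \<in> H. T x = \<mu> *\<^sub>C x}"

text \<open>Finite dimension, stated so that infinite-dimensional spaces have no dimension
  (the library's \<open>dim\<close> is 0 for them).\<close>

definition has_dim :: "'v::complex_vector set \<Rightarrow> nat \<Rightarrow> bool" where
  "has_dim W m \<longleftrightarrow> (\<exists>B. finite B \<and> card B = m \<and>
     complex_vector.independent B \<and> complex_vector.span B = W)"

definition eigenvalue_of_mult ::
    "'v::complex_vector set \<Rightarrow> ('v \<Rightarrow> 'v) \<Rightarrow> complex \<Rightarrow> nat \<Rightarrow> bool" where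
  "eigenvalue_of_mult H T \<mu> m \<longleftrightarrow> m > 0 \<and> has_dim (eigenspace H T \<mu>) m"

text \<open>Singular values of an operator with domain \<open>V\<close>: the square roots of the eigenvalues
  of \<open>T\<^sup>* T\<close>, counted with the multiplicity of the latter.\<close>

definition singular_value :: "'v::complex_vector inner_prod \<Rightarrow> 'v set \<Rightarrow> ('v \<Rightarrow> 'v) \<Rightarrow> real \<Rightarrow> bool" where
  "singular_value ip V T s \<longleftrightarrow> s \<ge> 0 \<and>
     eigenspace V (adjoint_on ip V T \<circ> T) (complex_of_real (s\<^sup>2)) \<noteq> {0}"

definition singular_value_of_mult ::
    "'v::complex_vector inner_prod \<Rightarrow> 'v set \<Rightarrow> ('v \<Rightarrow> 'v) \<Rightarrow> real \<Rightarrow> nat \<Rightarrow> bool" where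
  "singular_value_of_mult ip V T s m \<longleftrightarrow> s \<ge> 0 \<and>
     eigenvalue_of_mult V (adjoint_on ip V T \<circ> T) (complex_of_real (s\<^sup>2)) m"

definition orthonormal_basis ::
    "'v::complex_vector inner_prod \<Rightarrow> 'v set \<Rightarrow> 'i set \<Rightarrow> ('i \<Rightarrow> 'v) \<Rightarrow> bool" where
  "orthonormal_basis ip E I e \<longleftrightarrow> e ` I \<subseteq> E \<and>
     (\<forall>i\<in>I. \<forall>j\<in>I. ip (e i) (e j) = (if i = j then 1 else 0)) \<and>
     ip_topology ip E closure_of (complex_vector.span (e ` I)) = E"

text \<open>Entry in row \<open>j\<close>, column \<open>i\<close> of the matrix of \<open>T\<close>: the \<open>f j\<close>-coordinate of \<open>T (e i)\<close>.\<close>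

definition op_matrix ::
    "'v inner_prod \<Rightarrow> ('v \<Rightarrow> 'v) \<Rightarrow> ('i \<Rightarrow> 'v) \<Rightarrow> ('j \<Rightarrow> 'v) \<Rightarrow> 'j \<Rightarrow> 'i \<Rightarrow> complex" where
  "op_matrix ip T e f j i = ip (T (e i)) (f j)"


section \<open>Haar measure on the torus and the weighted measure\<close>

definition haar_circle :: "complex measure" where
  "haar_circle = distr (uniform_measure lborel {0..<1::real})
     (restrict_space borel (sphere 0 1)) (\<lambda>t. cis (2 * pi * t))"

definition haar_torus :: "(complex \<times> complex) measure" where
  "haar_torus = haar_circle \<Otimes>\<^sub>M haar_circle"

text \<open>\<open>\<complex>[z,w]\<close> is rendered as \<open>\<complex>[z][w]\<close>: the outer variable is \<open>w\<close>, the coefficients are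
  polynomials in \<open>z\<close>.\<close>

definition bipoly_eval :: "complex poly poly \<Rightarrow> complex \<times> complex \<Rightarrow> complex" where
  "bipoly_eval p x = poly (poly p [:snd x:]) (fst x)"

definition nu_measure :: "complex poly poly \<Rightarrow> (complex \<times> complex) measure" where
  "nu_measure p = density haar_torus (\<lambda>x. ennreal ((cmod (bipoly_eval p x))\<^sup>2 /
     (\<integral>y. (cmod (bipoly_eval p y))\<^sup>2 \<partial>haar_torus)))"

lemma measurable_cis_circle:
  "(\<lambda>t::real. cis (2 * pi * t)) \<in> measurable (uniform_measure lborel {0..<1}) (restrict_space borel (sphere 0 1))"
proof -
  have "(\<lambda>t::real. cis (2 * pi * t)) \<in> borel_measurable borel"
    by (intro borel_measurable_continuous_onI continuous_intros)
  then have "(\<lambda>t::real. cis (2 * pi * t)) \<in> measurable borel (restrict_space borel (sphere 0 1))"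
    by (intro measurable_restrict_space2) auto
  then show ?thesis
    by (simp cong: measurable_cong_sets)
qed

lemma prob_space_haar_circle: "prob_space haar_circle"
  unfolding haar_circle_def
  by (intro prob_space.prob_space_distr prob_space_uniform_measure measurable_cis_circle) auto

lemma space_haar_torus: "space haar_torus = sphere 0 1 \<times> sphere 0 1"
  by (simp add: haar_torus_def haar_circle_def space_pair_measure space_restrict_space)

lemma borel_measurable_haar_circle: "(\<lambda>z. z) \<in> borel_measurable haar_circle"
  unfolding haar_circle_def by (simp add: measurable_restrict_space1)

lemma borel_measurable_fst_torus [measurable]: "fst \<in> borel_measurable haar_torus"
  unfolding haar_torus_def
  using measurable_comp[OF measurable_fst borel_measurable_haar_circle] by (simp add: comp_def)

lemma borel_measurable_snd_torus [measurable]: "snd \<in> borel_measurable haar_torus"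
  unfolding haar_torus_def
  using measurable_comp[OF measurable_snd borel_measurable_haar_circle] by (simp add: comp_def)

lemma borel_measurable_poly_torus:
  "(\<lambda>x. poly a (fst x)) \<in> borel_measurable haar_torus" for a :: "complex poly"
  by (induction a) auto

lemma borel_measurable_bipoly_eval [measurable]: "bipoly_eval p \<in> borel_measurable haar_torus"
proof -
  have "(\<lambda>x. poly (poly p [:snd x:]) (fst x)) \<in> borel_measurable haar_torus"
    by (induction p) (auto intro!: borel_measurable_add borel_measurable_times
          simp: borel_measurable_poly_torus)
  then show ?thesis by (simp add: bipoly_eval_def[abs_def])
qed

lemma sets_nu_measure [simp, measurable_cong]: "sets (nu_measure p) = sets haar_torus"
  by (simp add: nu_measure_def)

lemma AE_haar_imp_AE_nu: "AE x in haar_torus. P x \<Longrightarrow> AE x in nu_measure p. P x"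
  unfolding nu_measure_def by (subst AE_density) auto

lemma AE_haar_circle_neq: "AE z in haar_circle. z \<noteq> c"
proof -
  have "inj_on (\<lambda>t. cis (2 * pi * t)) {0..<1::real}"
  proof (rule inj_onI)
    fix s t :: real assume st: "s \<in> {0..<1}" "t \<in> {0..<1}" and eq: "cis (2 * pi * s) = cis (2 * pi * t)"
    have "cis (2 * pi * s - 2 * pi * t) = 1"
      using eq by (simp flip: cis_divide)
    then have "cos (2 * pi * s - 2 * pi * t) = 1" by (simp add: complex_eq_iff)
    then obtain n :: int where "2 * pi * s - 2 * pi * t = of_int n * 2 * pi"
      using cos_one_2pi_int by blast
    then have "2 * pi * (s - t) = 2 * pi * of_int n" by (simp add: algebra_simps)
    then have "s - t = of_int n" by simp
    moreover from this have "\<bar>of_int n :: real\<bar> < 1" using st by auto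
    then have "n = 0" by linarith
    ultimately show "s = t" by simp
  qed
  then have "finite ((\<lambda>t. cis (2 * pi * t)) -` {c} \<inter> {0..<1})"
    by (intro finite_vimage_IntI) auto
  then have "AE t in lborel. t \<notin> (\<lambda>t. cis (2 * pi * t)) -` {c} \<inter> {0..<1::real}"
    by (intro AE_not_in countable_imp_null_set_lborel countable_finite)
  then have "AE t in uniform_measure lborel {0..<1::real}. cis (2 * pi * t) \<noteq> c"
    by (intro AE_uniform_measureI) auto
  moreover have "{z \<in> space (restrict_space borel (sphere 0 1)). z \<noteq> c}
      \<in> sets (restrict_space borel (sphere (0::complex) 1))"
    using measurable_sets[OF borel_measurable_haar_circle, of "- {c}"]
    by (simp add: haar_circle_def vimage_def Int_def conj_commute)
  ultimately show ?thesis
    unfolding haar_circle_def by (subst AE_distr_iff[OF measurable_cis_circle]) auto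
qed

lemma AE_haar_circle_poly_neq_0:
  assumes "q \<noteq> 0"
  shows "AE z in haar_circle. poly q z \<noteq> 0"
proof -
  have "AE z in haar_circle. \<forall>c\<in>{z. poly q z = 0}. z \<noteq> c"
    using poly_roots_finite[OF assms] AE_haar_circle_neq
    by (subst AE_ball_countable) (auto intro: countable_finite)
  then show ?thesis by (rule AE_mp) auto
qed

lemma AE_bipoly_eval_neq_0:
  assumes "p \<noteq> 0"
  shows "AE x in haar_torus. bipoly_eval p x \<noteq> 0"
proof -
  interpret prob_space haar_circle by (rule prob_space_haar_circle)
  interpret pair_sigma_finite haar_circle haar_circle ..
  have eval: "poly (poly p [:w:]) z = poly (map_poly (\<lambda>a. poly a z) p) w" for w z
    by (induction p) (auto simp: map_poly_pCons)
  have "AE z in haar_circle. poly (lead_coeff p) z \<noteq> 0"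
    using assms by (intro AE_haar_circle_poly_neq_0) auto
  then have "AE z in haar_circle. AE w in haar_circle. bipoly_eval p (z, w) \<noteq> 0"
  proof eventually_elim
    case (elim z)
    then have "coeff (map_poly (\<lambda>a. poly a z) p) (degree p) \<noteq> 0"
      by (simp add: coeff_map_poly)
    then have "map_poly (\<lambda>a. poly a z) p \<noteq> 0" by auto
    from AE_haar_circle_poly_neq_0[OF this]
    show "AE w in haar_circle. bipoly_eval p (z, w) \<noteq> 0"
      by (simp add: bipoly_eval_def eval)
  qed
  moreover have "{x \<in> space haar_torus. bipoly_eval p x \<noteq> 0} \<in> sets haar_torus"
    by measurable
  ultimately show ?thesis
    unfolding haar_torus_def by (intro AE_pair_measure[where P = "\<lambda>x. bipoly_eval p x \<noteq> 0"])
qed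

lemma norm_bipoly_pos:
  assumes "p \<noteq> 0"
  shows "(\<integral>y. (cmod (bipoly_eval p y))\<^sup>2 \<partial>haar_torus) > 0"
proof -
  interpret prob_space haar_circle by (rule prob_space_haar_circle)
  interpret T: prob_space haar_torus
    unfolding haar_torus_def by (rule prob_space_pair) (rule prob_space_haar_circle)+
  have "continuous_on (sphere 0 1 \<times> sphere 0 1) (bipoly_eval p)"
  proof -
    have 1: "continuous_on UNIV (\<lambda>x::complex \<times> complex. poly a (fst x))" for a :: "complex poly"
      by (intro continuous_intros)
    have "continuous_on UNIV (\<lambda>x. poly (poly p [:snd x:]) (fst x))"
      by (induction p) (auto intro!: continuous_intros 1)
    then show ?thesis
      unfolding bipoly_eval_def[abs_def] by (rule continuous_on_subset) auto
  qed
  then have "compact (bipoly_eval p ` (sphere 0 1 \<times> sphere 0 1))"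
    by (intro compact_continuous_image compact_Times compact_sphere)
  then obtain B where B: "\<And>x. x \<in> sphere 0 1 \<times> sphere 0 1 \<Longrightarrow> cmod (bipoly_eval p x) \<le> B"
    by (metis compact_imp_bounded bounded_iff imageI)
  have int: "integrable haar_torus (\<lambda>y. (cmod (bipoly_eval p y))\<^sup>2)"
    by (rule T.integrable_const_bound[where B = "B\<^sup>2"])
      (auto intro!: AE_I2 power_mono B simp: space_haar_torus)
  have "(\<integral>y. (cmod (bipoly_eval p y))\<^sup>2 \<partial>haar_torus) \<noteq> 0"
  proof
    assume "(\<integral>y. (cmod (bipoly_eval p y))\<^sup>2 \<partial>haar_torus) = 0"
    then have "AE y in haar_torus. (cmod (bipoly_eval p y))\<^sup>2 = 0"
      using int by (subst (asm) integral_nonneg_eq_0_iff_AE) auto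
    with AE_bipoly_eval_neq_0[OF assms] have "AE y in haar_torus. False"
      by eventually_elim auto
    then show False by simp
  qed
  then show ?thesis
    by (simp add: less_le)
qed

text \<open>Since \<open>\<nu>\<^sub>p\<close> and Haar measure have the same null sets, equality \<open>\<nu>\<^sub>p\<close>-almost everywhere is
  the same relation for all \<open>p \<noteq> 0\<close>; this is why all the spaces \<open>L\<^sup>2(\<nu>\<^sub>p)\<close> can be realised
  below as sets of elements of one type.\<close>

lemma AE_nu_measure_iff:
  assumes "p \<noteq> 0"
  shows "(AE x in nu_measure p. P x) \<longleftrightarrow> (AE x in haar_torus. P x)"
proof
  assume "AE x in nu_measure p. P x"
  then have "AE x in haar_torus. 0 < ennreal ((cmod (bipoly_eval p x))\<^sup>2 /
     (\<integral>y. (cmod (bipoly_eval p y))\<^sup>2 \<partial>haar_torus)) \<longrightarrow> P x"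
    unfolding nu_measure_def by (subst (asm) AE_density) auto
  with AE_bipoly_eval_neq_0[OF assms] show "AE x in haar_torus. P x"
    by eventually_elim (use norm_bipoly_pos[OF assms] in auto)
qed (rule AE_haar_imp_AE_nu)


section \<open>Measurable functions on the torus modulo null sets\<close>

quotient_type torus_fun = "complex \<times> complex \<Rightarrow> complex" / partial:
  "\<lambda>f g. f \<in> borel_measurable haar_torus \<and> g \<in> borel_measurable haar_torus \<and>
     (AE x in haar_torus. f x = g x)"
proof (rule part_equivpI)
  show "\<exists>f. f \<in> borel_measurable haar_torus \<and> f \<in> borel_measurable haar_torus \<and>
      (AE x in haar_torus. f x = (f x :: complex))"
    by (intro exI[of _ "\<lambda>_. 0"]) auto
qed (auto intro!: sympI transpI elim: AE_mp)

instantiation torus_fun :: complex_vector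
begin

lift_definition zero_torus_fun :: torus_fun is "\<lambda>_. 0" by auto

lift_definition plus_torus_fun :: "torus_fun \<Rightarrow> torus_fun \<Rightarrow> torus_fun"
  is "\<lambda>f g x. f x + g x" by (auto elim: AE_mp)

lift_definition minus_torus_fun :: "torus_fun \<Rightarrow> torus_fun \<Rightarrow> torus_fun"
  is "\<lambda>f g x. f x - g x" by (auto elim: AE_mp)

lift_definition uminus_torus_fun :: "torus_fun \<Rightarrow> torus_fun"
  is "\<lambda>f x. - f x" by (auto elim: AE_mp)

lift_definition scaleC_torus_fun :: "complex \<Rightarrow> torus_fun \<Rightarrow> torus_fun"
  is "\<lambda>c f x. c * f x" by (auto elim: AE_mp)

instance
  by standard (transfer; auto simp: algebra_simps)+

end

lift_definition torus_poly :: "complex poly poly \<Rightarrow> torus_fun" is bipoly_eval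
  by auto

lift_definition mult_z :: "torus_fun \<Rightarrow> torus_fun" is "\<lambda>f x. fst x * f x"
  by (auto elim: AE_mp)

lift_definition mult_w :: "torus_fun \<Rightarrow> torus_fun" is "\<lambda>f x. snd x * f x"
  by (auto elim: AE_mp)

lift_definition ip_nu :: "complex poly poly \<Rightarrow> torus_fun inner_prod" is
  "\<lambda>p f g. \<integral>x. f x * cnj (g x) \<partial>nu_measure p"
proof -
  fix p and f f' g g' :: "complex \<times> complex \<Rightarrow> complex"
  assume f: "f \<in> borel_measurable haar_torus \<and> f' \<in> borel_measurable haar_torus \<and>
      (AE x in haar_torus. f x = f' x)"
    and g: "g \<in> borel_measurable haar_torus \<and> g' \<in> borel_measurable haar_torus \<and>
      (AE x in haar_torus. g x = g' x)"
  have "AE x in nu_measure p. f x = f' x" "AE x in nu_measure p. g x = g' x"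
    using f g by (auto intro: AE_haar_imp_AE_nu)
  then have "AE x in nu_measure p. f x * cnj (g x) = f' x * cnj (g' x)"
    by eventually_elim auto
  moreover have "cnj \<in> borel_measurable borel"
    by (intro borel_measurable_continuous_onI continuous_intros)
  then have "(\<lambda>x. cnj (g x)) \<in> borel_measurable haar_torus" "(\<lambda>x. cnj (g' x)) \<in> borel_measurable haar_torus"
    using f g by (auto intro: measurable_compose)
  ultimately show "(\<integral>x. f x * cnj (g x) \<partial>nu_measure p) = (\<integral>x. f' x * cnj (g' x) \<partial>nu_measure p)"
    using f g by (intro integral_cong_AE) (auto cong: measurable_cong_sets)
qed

lift_definition square_integrable :: "complex poly poly \<Rightarrow> torus_fun \<Rightarrow> bool" is
  "\<lambda>p f. integrable (nu_measure p) (\<lambda>x. (cmod (f x))\<^sup>2)"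
proof -
  fix p and f g :: "complex \<times> complex \<Rightarrow> complex"
  assume f: "f \<in> borel_measurable haar_torus \<and> g \<in> borel_measurable haar_torus \<and>
      (AE x in haar_torus. f x = g x)"
  then have "AE x in nu_measure p. f x = g x"
    by (auto intro: AE_haar_imp_AE_nu)
  then have "AE x in nu_measure p. (cmod (f x))\<^sup>2 = (cmod (g x))\<^sup>2"
    by eventually_elim auto
  then show "integrable (nu_measure p) (\<lambda>x. (cmod (f x))\<^sup>2) =
      integrable (nu_measure p) (\<lambda>x. (cmod (g x))\<^sup>2)"
    using f by (intro integrable_cong_AE) (auto cong: measurable_cong_sets)
qed


section \<open>The weighted model\<close>

definition L2_nu :: "complex poly poly \<Rightarrow> torus_fun set" where
  "L2_nu p = {f. square_integrable p f}"

definition H_space :: "complex poly poly \<Rightarrow> torus_fun set" where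
  "H_space p = ip_topology (ip_nu p) (L2_nu p) closure_of (range torus_poly)"

definition E_z :: "complex poly poly \<Rightarrow> torus_fun set" where
  "E_z p = ortho_minus (ip_nu p) (H_space p) (mult_z ` H_space p)"

definition E_w :: "complex poly poly \<Rightarrow> torus_fun set" where
  "E_w p = ortho_minus (ip_nu p) (H_space p) (mult_w ` H_space p)"

definition Q_z :: "complex poly poly \<Rightarrow> torus_fun \<Rightarrow> torus_fun" where
  "Q_z p = ortho_proj (ip_nu p) (E_z p)"

definition Q_w :: "complex poly poly \<Rightarrow> torus_fun \<Rightarrow> torus_fun" where
  "Q_w p = ortho_proj (ip_nu p) (E_w p)"

text \<open>Adjoints of \<open>S\<^sub>z\<close>, \<open>S\<^sub>w\<close> are taken on \<open>H_space p\<close>, not on \<open>L\<^sup>2(\<nu>\<^sub>p)\<close>.\<close>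

definition adj_z :: "complex poly poly \<Rightarrow> torus_fun \<Rightarrow> torus_fun" where
  "adj_z p = adjoint_on (ip_nu p) (H_space p) mult_z"

definition adj_w :: "complex poly poly \<Rightarrow> torus_fun \<Rightarrow> torus_fun" where
  "adj_w p = adjoint_on (ip_nu p) (H_space p) mult_w"

definition core_op :: "complex poly poly \<Rightarrow> torus_fun \<Rightarrow> torus_fun" where
  "core_op p f = f - mult_z (adj_z p f) - mult_w (adj_w p f)
     + mult_z (mult_w (adj_z p (adj_w p f)))"

definition Gamma_op :: "complex poly poly \<Rightarrow> torus_fun \<Rightarrow> torus_fun" where
  "Gamma_op p = restrict (Q_w p) (E_z p)"

definition Gamma_adj :: "complex poly poly \<Rightarrow> torus_fun \<Rightarrow> torus_fun" where
  "Gamma_adj p = adjoint_on (ip_nu p) (E_z p) (Gamma_op p)"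

definition endpoint_plus :: "complex poly poly \<Rightarrow> torus_fun set" where
  "endpoint_plus p = ortho_minus (ip_nu p) (H_space p)
     {f + g | f g. f \<in> mult_z ` H_space p \<and> g \<in> mult_w ` H_space p}"

definition endpoint_minus :: "complex poly poly \<Rightarrow> torus_fun set" where
  "endpoint_minus p = ortho_minus (ip_nu p) (mult_z ` H_space p \<inter> mult_w ` H_space p)
     ((\<lambda>f. mult_z (mult_w f)) ` H_space p)"

end

(*
  Writing E, F for the projections of H_p onto E_z, E_w and S for the projection onto zw H_p, the core
  operator is C = E + F - 1 + S with S orthogonal to E and F. Hence C = F on E_z and C = E on E_w, which
  gives C^2 = E F E on E_z, and C x = mu x implies E F E x = mu^2 E x. For mu different from 0 and -1 the
  map E is thus a bijection from ker (C - mu) onto ker (E F - mu^2) in E_z, with inverse a multiple of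
  y |-> mu y + F y; injectivity holds because C acts as the negative of a projection on ker E. Since C is
  the difference of the projections E and 1 - F - S, its eigenvalues lie in [-1, 1], and the endpoint
  eigenspaces are read off from the equality cases. For compact C every non-zero spectral point is an
  eigenvalue of finite multiplicity.
*)

theory Submission
  imports Defs
begin

section \<open>Hilbert spaces carried by a set\<close>

text \<open>All the spaces L^2(nu_p) share one type, and their inner products are meaningful only on
  their carriers, so the Hilbert space theory, up to the spectrum of compact self-adjoint operators,
  is developed relative to a carrier set. S is orthogonal to E and F because zw H_p lies inside both
  z H_p and w H_p. Otherwise E and F are two projections in arbitrary position. If y in E_z
  satisfies E F y = \<mu>^2 y, then C y = F y and C F y = \<mu>^2 y, so C maps the span of y and F y
  into itself, with \<mu> y + F y and - \<mu> y + F y as candidate eigenvectors for \<mu> and -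
  \<mu>. This is the origin of the symmetry between s and -s. The symmetry breaks at s = 1: there F
  y = y, so - y + F y = 0 and the partner at -1 disappears. Conversely ker (C + 1) lies inside ker
  E, where Gamma cannot see it. Hence the two endpoints have to be described by spaces of their
  own.\<close>

locale pre_hilbert =
  fixes ip :: "'v::complex_vector inner_prod" and H :: "'v set"
  assumes subspace_H: "complex_vector.subspace H"
    and ip_add_left: "\<lbrakk>x \<in> H; y \<in> H; z \<in> H\<rbrakk> \<Longrightarrow> ip (x + y) z = ip x z + ip y z"
    and ip_scale_left: "\<lbrakk>x \<in> H; y \<in> H\<rbrakk> \<Longrightarrow> ip (c *\<^sub>C x) y = c * ip x y"
    and ip_commute: "\<lbrakk>x \<in> H; y \<in> H\<rbrakk> \<Longrightarrow> ip y x = cnj (ip x y)"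
    and ip_ge_0: "x \<in> H \<Longrightarrow> 0 \<le> Re (ip x x)"
    and ip_eq_0D: "\<lbrakk>x \<in> H; ip x x = 0\<rbrakk> \<Longrightarrow> x = 0"
    \<comment> \<open>Metric_space wants a distance that is symmetric on the whole type, also off \<open>H\<close>.\<close>
    and ip_minus_minus: "ip (- x) (- y) = ip x y"
begin

lemma H_zero [simp, intro]: "0 \<in> H"
  and H_add [simp, intro]: "\<lbrakk>x \<in> H; y \<in> H\<rbrakk> \<Longrightarrow> x + y \<in> H"
  and H_diff [simp, intro]: "\<lbrakk>x \<in> H; y \<in> H\<rbrakk> \<Longrightarrow> x - y \<in> H"
  and H_scale [simp, intro]: "x \<in> H \<Longrightarrow> c *\<^sub>C x \<in> H"
  and H_minus [simp, intro]: "x \<in> H \<Longrightarrow> - x \<in> H"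
  using subspace_H
  by (simp_all add: complex_vector.subspace_0 complex_vector.subspace_add
      complex_vector.subspace_diff complex_vector.subspace_scale complex_vector.subspace_neg)

lemma ip_zero_left [simp]: "y \<in> H \<Longrightarrow> ip 0 y = 0"
  using ip_scale_left[of 0 y 0] by simp

lemma ip_minus_left [simp]: "\<lbrakk>x \<in> H; y \<in> H\<rbrakk> \<Longrightarrow> ip (- x) y = - ip x y"
  using ip_scale_left[of x y "-1"] by simp

lemma ip_diff_left: "\<lbrakk>x \<in> H; y \<in> H; z \<in> H\<rbrakk> \<Longrightarrow> ip (x - y) z = ip x z - ip y z"
  using ip_add_left[of x "- y" z] by simp

lemma ip_add_right: "\<lbrakk>x \<in> H; y \<in> H; z \<in> H\<rbrakk> \<Longrightarrow> ip x (y + z) = ip x y + ip x z"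
  using ip_commute[of "y + z" x] ip_commute[of y x] ip_commute[of z x] by (simp add: ip_add_left)

lemma ip_diff_right: "\<lbrakk>x \<in> H; y \<in> H; z \<in> H\<rbrakk> \<Longrightarrow> ip x (y - z) = ip x y - ip x z"
  using ip_commute[of "y - z" x] ip_commute[of y x] ip_commute[of z x] by (simp add: ip_diff_left)

lemma ip_scale_right: "\<lbrakk>x \<in> H; y \<in> H\<rbrakk> \<Longrightarrow> ip x (c *\<^sub>C y) = cnj c * ip x y"
  using ip_commute[of "c *\<^sub>C y" x] ip_commute[of y x] by (simp add: ip_scale_left)

lemma ip_minus_right [simp]: "\<lbrakk>x \<in> H; y \<in> H\<rbrakk> \<Longrightarrow> ip x (- y) = - ip x y"
  using ip_scale_right[of x y "-1"] by simp

lemma ip_zero_right [simp]: "x \<in> H \<Longrightarrow> ip x 0 = 0"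
  using ip_commute[of 0 x] by simp

lemmas ip_linear = ip_add_left ip_add_right ip_diff_left ip_diff_right ip_scale_left ip_scale_right

lemma ip_eq_0_commute: "\<lbrakk>x \<in> H; y \<in> H\<rbrakk> \<Longrightarrow> ip x y = 0 \<longleftrightarrow> ip y x = 0"
  using ip_commute[of x y] by simp

text \<open>Testing with \<open>x - y\<close> itself shows that the form is nondegenerate.
  Identities between adjoints are proved in this weak form.\<close>

lemma ip_cancel:
  assumes "x \<in> H" "y \<in> H" "\<And>z. z \<in> H \<Longrightarrow> ip z x = ip z y"
  shows "x = y"
  using assms ip_eq_0D[of "x - y"] by (auto simp: ip_diff_right)

lemma ip_norm_ge_0 [simp]: "0 \<le> ip_norm ip x"
  by (simp add: ip_norm_def)

text \<open>Conjugate symmetry makes the form real on the diagonal and positivity fixes the sign, so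
  the \<open>cmod\<close> inside \<open>ip_norm\<close> changes nothing.\<close>

lemma ip_self: "x \<in> H \<Longrightarrow> ip x x = complex_of_real ((ip_norm ip x)\<^sup>2)"
  using ip_commute[of x x] ip_ge_0[of x]
  by (auto simp: ip_norm_def complex_eq_iff cmod_def)

lemma ip_norm_eq_0 [simp]: "x \<in> H \<Longrightarrow> ip_norm ip x = 0 \<longleftrightarrow> x = 0"
  using ip_self[of x] ip_eq_0D[of x] by (auto simp: ip_norm_def)

lemma ip_norm_zero [simp]: "ip_norm ip 0 = 0"
  by simp

lemma ip_norm_scale: "x \<in> H \<Longrightarrow> ip_norm ip (c *\<^sub>C x) = cmod c * ip_norm ip x"
  by (simp add: ip_norm_def ip_linear norm_mult real_sqrt_mult)

lemma ip_norm_minus [simp]: "x \<in> H \<Longrightarrow> ip_norm ip (- x) = ip_norm ip x"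
  by (simp add: ip_norm_def)

lemma ip_norm_add_sq:
  assumes "x \<in> H" "y \<in> H"
  shows "(ip_norm ip (x + y))\<^sup>2 = (ip_norm ip x)\<^sup>2 + (ip_norm ip y)\<^sup>2 + 2 * Re (ip x y)"
proof -
  have "Re (ip (x + y) (x + y)) = Re (ip x x) + Re (ip y y) + 2 * Re (ip x y)"
    using assms ip_commute[of x y] by (simp add: ip_linear)
  then show ?thesis using assms by (simp add: ip_self)
qed

lemma ip_norm_diff_sq:
  assumes "x \<in> H" "y \<in> H"
  shows "(ip_norm ip (x - y))\<^sup>2 = (ip_norm ip x)\<^sup>2 + (ip_norm ip y)\<^sup>2 - 2 * Re (ip x y)"
  using assms ip_norm_add_sq[of x "- y"] by simp

lemma parallelogram:
  assumes "x \<in> H" "y \<in> H"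
  shows "(ip_norm ip (x + y))\<^sup>2 + (ip_norm ip (x - y))\<^sup>2 = 2 * (ip_norm ip x)\<^sup>2 + 2 * (ip_norm ip y)\<^sup>2"
  using assms by (simp add: ip_norm_add_sq ip_norm_diff_sq)

text \<open>The component of \<open>x\<close> along \<open>y\<close> is removed. That the left side
  is nonnegative is Cauchy-Schwarz; the exact decrease also forces orthogonality at a nearest point
  in \<open>projection_exists\<close>.\<close>

lemma ip_norm_diff_proj_sq:
  assumes "x \<in> H" "y \<in> H" "y \<noteq> 0"
  shows "(ip_norm ip (x - (ip x y / ip y y) *\<^sub>C y))\<^sup>2 = (ip_norm ip x)\<^sup>2 - (cmod (ip x y))\<^sup>2 / (ip_norm ip y)\<^sup>2"
proof -
  let ?c = "ip x y / ip y y" and ?n = "(ip_norm ip y)\<^sup>2"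
  have n: "ip y y = complex_of_real ?n" "?n \<noteq> 0" using assms by (auto simp: ip_self)
  have c: "(cmod ?c)\<^sup>2 * ?n = (cmod (ip x y))\<^sup>2 / ?n"
    using n by (simp add: norm_divide norm_mult power_divide power2_eq_square)
  have "ip x (?c *\<^sub>C y) = complex_of_real ((cmod (ip x y))\<^sup>2 / ?n)"
    using assms n complex_norm_square[of "ip x y"] by (simp add: ip_linear mult.commute)
  then show ?thesis
    using assms c by (simp add: ip_norm_diff_sq ip_norm_scale power_mult_distrib)
qed

lemma cauchy_schwarz:
  assumes "x \<in> H" "y \<in> H"
  shows "cmod (ip x y) \<le> ip_norm ip x * ip_norm ip y"
proof (cases "y = 0")
  case False
  then have n: "(ip_norm ip y)\<^sup>2 > 0" using assms by simp
  have "0 \<le> (ip_norm ip x)\<^sup>2 - (cmod (ip x y))\<^sup>2 / (ip_norm ip y)\<^sup>2"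
    using ip_norm_diff_proj_sq[OF assms False] by (metis zero_le_power2)
  then have "(cmod (ip x y))\<^sup>2 \<le> (ip_norm ip x * ip_norm ip y)\<^sup>2"
    using n by (simp add: field_simps power_mult_distrib)
  then show ?thesis by (rule power2_le_imp_le) simp
qed (use assms in simp)

lemma ip_norm_triangle:
  assumes "x \<in> H" "y \<in> H"
  shows "ip_norm ip (x + y) \<le> ip_norm ip x + ip_norm ip y"
proof (rule power2_le_imp_le)
  have "Re (ip x y) \<le> ip_norm ip x * ip_norm ip y"
    using cauchy_schwarz[OF assms] complex_Re_le_cmod order_trans by blast
  then show "(ip_norm ip (x + y))\<^sup>2 \<le> (ip_norm ip x + ip_norm ip y)\<^sup>2"
    using assms by (simp add: ip_norm_add_sq power2_sum)
qed simp

lemma ip_dist_commute: "ip_dist ip x y = ip_dist ip y x"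
  using ip_minus_minus[of "x - y" "x - y"] by (simp add: ip_dist_def ip_norm_def)

sublocale M: Metric_space H "ip_dist ip"
proof
  fix x y z assume "x \<in> H" "y \<in> H" "z \<in> H"
  then show "ip_dist ip x z \<le> ip_dist ip x y + ip_dist ip y z"
    using ip_norm_triangle[of "x - y" "y - z"] by (simp add: ip_dist_def)
qed (simp_all add: ip_dist_commute, simp_all add: ip_dist_def)

lemma ip_topology_eq: "ip_topology ip H = M.mtopology"
  by (simp add: ip_topology_def)

end

section \<open>Limits, closed subspaces and bounded operators\<close>

context pre_hilbert
begin

lemma limitin_iff:
  "limitin M.mtopology \<sigma> l sequentially \<longleftrightarrow>
     l \<in> H \<and> (\<forall>\<^sub>F n in sequentially. \<sigma> n \<in> H) \<and> (\<lambda>n. ip_norm ip (\<sigma> n - l)) \<longlonglongrightarrow> 0"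
  by (simp add: M.limitin_metric_dist_null ip_dist_def)

lemma tendsto_ip_left:
  assumes "\<And>n. \<sigma> n \<in> H" "l \<in> H" "x \<in> H" and lim: "(\<lambda>n. ip_norm ip (\<sigma> n - l)) \<longlonglongrightarrow> 0"
  shows "(\<lambda>n. ip (\<sigma> n) x) \<longlonglongrightarrow> ip l x"
proof -
  have "cmod (ip (\<sigma> n) x - ip l x) \<le> ip_norm ip (\<sigma> n - l) * ip_norm ip x" for n
    using cauchy_schwarz[of "\<sigma> n - l" x] assms by (simp add: ip_diff_left)
  moreover have "(\<lambda>n. ip_norm ip (\<sigma> n - l) * ip_norm ip x) \<longlonglongrightarrow> 0"
    using tendsto_mult_right[OF lim] by simp
  ultimately have "(\<lambda>n. ip (\<sigma> n) x - ip l x) \<longlonglongrightarrow> 0"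
    by (rule Lim_null_comparison[OF always_eventually[OF allI]])
  then show ?thesis by (simp add: LIM_zero_iff)
qed

lemma ip_norm_diff_abs:
  assumes "x \<in> H" "y \<in> H"
  shows "\<bar>ip_norm ip x - ip_norm ip y\<bar> \<le> ip_norm ip (x - y)"
  using ip_norm_triangle[of "x - y" y] ip_norm_triangle[of "y - x" x] ip_norm_minus[of "x - y"] assms
  by simp

lemma tendsto_ip_norm:
  assumes "\<And>n. \<sigma> n \<in> H" "l \<in> H" and lim: "(\<lambda>n. ip_norm ip (\<sigma> n - l)) \<longlonglongrightarrow> 0"
  shows "(\<lambda>n. ip_norm ip (\<sigma> n)) \<longlonglongrightarrow> ip_norm ip l"
proof -
  have "(\<lambda>n. ip_norm ip (\<sigma> n) - ip_norm ip l) \<longlonglongrightarrow> 0"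
    by (rule Lim_null_comparison[OF _ lim]) (use assms ip_norm_diff_abs in auto)
  then show ?thesis by (simp add: LIM_zero_iff)
qed

lemma limit_unique:
  assumes "\<And>n. \<sigma> n \<in> H" "a \<in> H" "b \<in> H"
    and "(\<lambda>n. ip_norm ip (\<sigma> n - a)) \<longlonglongrightarrow> 0" "(\<lambda>n. ip_norm ip (\<sigma> n - b)) \<longlonglongrightarrow> 0"
  shows "a = b"
  using M.limitin_metric_unique[of \<sigma> a sequentially b] assms by (simp add: limitin_iff)

lemma closed_subspace_iff:
  "closed_subspace ip H W \<longleftrightarrow> W \<subseteq> H \<and> complex_vector.subspace W \<and>
     (\<forall>\<sigma> l. (\<forall>n. \<sigma> n \<in> W) \<longrightarrow> l \<in> H \<longrightarrow> (\<lambda>n. ip_norm ip (\<sigma> n - l)) \<longlonglongrightarrow> 0 \<longrightarrow> l \<in> W)"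
  (is "_ \<longleftrightarrow> _ \<and> _ \<and> ?C")
proof -
  have "closedin M.mtopology W \<longleftrightarrow> ?C" if W: "W \<subseteq> H"
  proof -
    have lim: "limitin M.mtopology \<sigma> l sequentially \<longleftrightarrow> l \<in> H \<and> (\<lambda>n. ip_norm ip (\<sigma> n - l)) \<longlonglongrightarrow> 0"
      if "\<forall>n. \<sigma> n \<in> W" for \<sigma> l
    proof -
      have "\<forall>n. \<sigma> n \<in> H" using that W by auto
      then show ?thesis by (simp add: limitin_iff)
    qed
    show ?thesis
      unfolding M.metric_closedin_iff_sequentially_closed image_subset_iff imp_conjL
      using W by (simp add: lim imp_conjL cong: imp_cong)
  qed
  then show ?thesis by (auto simp: closed_subspace_def ip_topology_eq)
qed

lemma pre_hilbert_subspace: "W \<subseteq> H \<Longrightarrow> complex_vector.subspace W \<Longrightarrow> pre_hilbert ip W"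
  by unfold_locales
    (auto simp: subset_iff ip_linear ip_ge_0 ip_minus_minus intro: ip_commute ip_eq_0D)

lemma subspace_ortho_minus:
  assumes "V \<subseteq> H" "complex_vector.subspace V" "W \<subseteq> H"
  shows "complex_vector.subspace (ortho_minus ip V W)"
  using assms by (auto simp: ortho_minus_def complex_vector.subspace_def ip_linear subset_iff)

text \<open>The set is an intersection of kernels of functionals \<open>\<lambda>x. ip x y\<close>,
  each continuous by Cauchy-Schwarz.\<close>

lemma closed_subspace_ortho_minus:
  assumes "W \<subseteq> H"
  shows "closed_subspace ip H (ortho_minus ip H W)"
  unfolding closed_subspace_iff
proof (intro conjI allI impI)
  fix \<sigma> l assume \<sigma>: "\<forall>n. \<sigma> n \<in> ortho_minus ip H W" "l \<in> H" "(\<lambda>n. ip_norm ip (\<sigma> n - l)) \<longlonglongrightarrow> 0"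
  have "ip l y = 0" if "y \<in> W" for y
  proof (rule LIMSEQ_unique)
    show "(\<lambda>n. ip (\<sigma> n) y) \<longlonglongrightarrow> ip l y"
      using \<sigma> that assms by (intro tendsto_ip_left) (auto simp: ortho_minus_def)
    show "(\<lambda>n. ip (\<sigma> n) y) \<longlonglongrightarrow> 0"
      using \<sigma> that by (simp add: ortho_minus_def)
  qed
  with \<open>l \<in> H\<close> show "l \<in> ortho_minus ip H W" by (simp add: ortho_minus_def)
qed (use assms subspace_H in \<open>auto intro: subspace_ortho_minus, auto simp: ortho_minus_def\<close>)

text \<open>Evaluates the definite description from one candidate: the difference of two candidates
  lies in \<open>W\<close> and is orthogonal to \<open>W\<close>, hence to itself.\<close>

lemma ortho_proj_eqI:
  assumes "W \<subseteq> H" "complex_vector.subspace W" "x \<in> H" "y \<in> W" "\<And>w. w \<in> W \<Longrightarrow> ip (x - y) w = 0"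
  shows "ortho_proj ip W x = y"
  unfolding ortho_proj_def
proof (rule the_equality)
  fix y' assume y': "y' \<in> W \<and> (\<forall>w\<in>W. ip (x - y') w = 0)"
  let ?d = "y - y'"
  have d: "?d \<in> W" using y' assms complex_vector.subspace_diff by blast
  have "ip ?d ?d = ip (x - y') ?d - ip (x - y) ?d"
    using d y' assms by (subst ip_diff_left[symmetric]) (auto simp: subset_iff)
  then have "ip ?d ?d = 0" using d y' assms by simp
  then show "y' = y" using ip_eq_0D[of ?d] d assms by auto
qed (use assms in auto)

text \<open>The form is already nondegenerate on \<open>V\<close>, so a representing vector in
  \<open>V\<close> is unique and exhibiting one evaluates the definite description. Applied with
  \<open>V\<close> the whole space for the shifts and with \<open>V\<close> the edge space for
  Gamma.\<close>

lemma adjoint_on_eqI: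
  assumes "V \<subseteq> H" "complex_vector.subspace V" "x \<in> V" "\<And>v. v \<in> V \<Longrightarrow> ip (T v) y = ip v x"
  shows "adjoint_on ip V T y = x"
  unfolding adjoint_on_def
proof (rule the_equality)
  interpret V: pre_hilbert ip V using assms by (intro pre_hilbert_subspace)
  fix x' assume "x' \<in> V \<and> (\<forall>v\<in>V. ip (T v) y = ip v x')"
  then show "x' = x" using assms by (intro V.ip_cancel) auto
qed (use assms in auto)

lemma bounded_opD:
  assumes "bounded_op ip H T"
  shows "x \<in> H \<Longrightarrow> T x \<in> H" "\<lbrakk>x \<in> H; y \<in> H\<rbrakk> \<Longrightarrow> T (x + y) = T x + T y"
    "x \<in> H \<Longrightarrow> T (c *\<^sub>C x) = c *\<^sub>C T x" "T 0 = 0"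
    "\<lbrakk>x \<in> H; y \<in> H\<rbrakk> \<Longrightarrow> T (x - y) = T x - T y" "x \<in> H \<Longrightarrow> T (- x) = - T x"
proof -
  show in_H: "x \<in> H \<Longrightarrow> T x \<in> H" and add: "\<lbrakk>x \<in> H; y \<in> H\<rbrakk> \<Longrightarrow> T (x + y) = T x + T y"
    and scale: "x \<in> H \<Longrightarrow> T (c *\<^sub>C x) = c *\<^sub>C T x" for x y c
    using assms by (auto simp: bounded_op_def)
  show "T 0 = 0" using scale[of 0 0] by simp
  show minus: "x \<in> H \<Longrightarrow> T (- x) = - T x" for x using scale[of x "-1"] by simp
  show "\<lbrakk>x \<in> H; y \<in> H\<rbrakk> \<Longrightarrow> T (x - y) = T x - T y" using add[of x "- y"] minus[of y] by simp
qed

lemma bounded_opI: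
  assumes "\<And>x. x \<in> H \<Longrightarrow> T x \<in> H" "\<And>x y. \<lbrakk>x \<in> H; y \<in> H\<rbrakk> \<Longrightarrow> T (x + y) = T x + T y"
    "\<And>c x. x \<in> H \<Longrightarrow> T (c *\<^sub>C x) = c *\<^sub>C T x"
    "\<And>x. x \<in> H \<Longrightarrow> ip_norm ip (T x) \<le> K * ip_norm ip x"
  shows "bounded_op ip H T"
  unfolding bounded_op_def using assms by (auto intro!: exI[of _ K])

lemma bounded_opE:
  assumes "bounded_op ip H T"
  obtains K where "K > 0" "\<And>x. x \<in> H \<Longrightarrow> ip_norm ip (T x) \<le> K * ip_norm ip x"
proof -
  obtain K where K: "\<And>x. x \<in> H \<Longrightarrow> ip_norm ip (T x) \<le> K * ip_norm ip x"
    using assms unfolding bounded_op_def by blast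
  \<comment> \<open>The bound in \<open>bounded_op\<close> may be 0, or even negative on a trivial
    carrier; multiplying estimates needs a positive factor.\<close>
  have "ip_norm ip (T x) \<le> max K 1 * ip_norm ip x" if "x \<in> H" for x
    by (rule order_trans[OF K[OF that]]) (simp add: mult_right_mono)
  then show ?thesis using that[of "max K 1"] by simp
qed

lemma bounded_op_id: "bounded_op ip H (\<lambda>x. x)"
  by (rule bounded_opI[where K = 1]) auto

lemma bounded_op_compose:
  assumes "bounded_op ip H S" "bounded_op ip H T"
  shows "bounded_op ip H (\<lambda>x. S (T x))"
proof -
  obtain K L where K: "K > 0" "\<And>x. x \<in> H \<Longrightarrow> ip_norm ip (S x) \<le> K * ip_norm ip x"
    and L: "\<And>x. x \<in> H \<Longrightarrow> ip_norm ip (T x) \<le> L * ip_norm ip x"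
    using assms by (metis bounded_opE)
  have "ip_norm ip (S (T x)) \<le> (K * L) * ip_norm ip x" if "x \<in> H" for x
    using order_trans[OF K(2)[OF bounded_opD(1)[OF assms(2) that]] mult_left_mono[OF L[OF that], of K]] K(1)
    by (simp add: mult.assoc)
  then show ?thesis
    using bounded_opD[OF assms(1)] bounded_opD[OF assms(2)] by (intro bounded_opI) auto
qed

lemma bounded_op_add:
  assumes "bounded_op ip H S" "bounded_op ip H T"
  shows "bounded_op ip H (\<lambda>x. S x + T x)"
proof -
  obtain K L where K: "\<And>x. x \<in> H \<Longrightarrow> ip_norm ip (S x) \<le> K * ip_norm ip x"
    and L: "\<And>x. x \<in> H \<Longrightarrow> ip_norm ip (T x) \<le> L * ip_norm ip x"
    using assms by (metis bounded_opE)
  have "ip_norm ip (S x + T x) \<le> (K + L) * ip_norm ip x" if "x \<in> H" for x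
    using ip_norm_triangle[of "S x" "T x"] K[OF that] L[OF that] bounded_opD(1) assms that
    by (force simp: distrib_right)
  then show ?thesis
    using bounded_opD[OF assms(1)] bounded_opD[OF assms(2)]
    by (intro bounded_opI[where K = "K + L"]) (auto simp: algebra_simps scaleC_add_right)
qed

lemma bounded_op_scale:
  assumes "bounded_op ip H T"
  shows "bounded_op ip H (\<lambda>x. c *\<^sub>C T x)"
proof -
  obtain K where K: "\<And>x. x \<in> H \<Longrightarrow> ip_norm ip (T x) \<le> K * ip_norm ip x"
    using assms by (metis bounded_opE)
  have "ip_norm ip (c *\<^sub>C T x) \<le> (cmod c * K) * ip_norm ip x" if "x \<in> H" for x
    using mult_left_mono[OF K[OF that], of "cmod c"] bounded_opD(1)[OF assms that]
    by (simp add: ip_norm_scale mult.assoc)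
  then show ?thesis
    using bounded_opD[OF assms]
    by (intro bounded_opI[where K = "cmod c * K"]) (auto simp: scaleC_add_right scaleC_scaleC mult.commute)
qed

lemma bounded_op_diff:
  assumes "bounded_op ip H S" "bounded_op ip H T"
  shows "bounded_op ip H (\<lambda>x. S x - T x)"
  using bounded_op_add[OF assms(1) bounded_op_scale[OF assms(2), of "-1"]] by simp

lemma tendsto_bounded_op:
  assumes "bounded_op ip H T" "\<And>n. \<sigma> n \<in> H" "l \<in> H" and lim: "(\<lambda>n. ip_norm ip (\<sigma> n - l)) \<longlonglongrightarrow> 0"
  shows "(\<lambda>n. ip_norm ip (T (\<sigma> n) - T l)) \<longlonglongrightarrow> 0"
proof -
  obtain K where K: "\<And>x. x \<in> H \<Longrightarrow> ip_norm ip (T x) \<le> K * ip_norm ip x"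
    using assms(1) by (metis bounded_opE)
  show ?thesis
  proof (rule Lim_null_comparison)
    show "(\<lambda>n. K * ip_norm ip (\<sigma> n - l)) \<longlonglongrightarrow> 0" using tendsto_mult_left[OF lim] by simp
    show "\<forall>\<^sub>F n in sequentially. norm (ip_norm ip (T (\<sigma> n) - T l)) \<le> K * ip_norm ip (\<sigma> n - l)"
      using K[of "\<sigma> _ - l"] assms by (simp add: bounded_opD)
  qed
qed

end

section \<open>Completeness and the projection theorem\<close>

locale hilbert = pre_hilbert ip H for ip :: "'v::complex_vector inner_prod" and H +
  assumes mcomplete: "M.mcomplete"
begin

lemma Cauchy_convergent:
  assumes "\<And>n. \<sigma> n \<in> H"
    and "\<And>\<epsilon>. \<epsilon> > 0 \<Longrightarrow> \<exists>N. \<forall>m\<ge>N. \<forall>n\<ge>N. ip_norm ip (\<sigma> m - \<sigma> n) < \<epsilon>"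
  obtains l where "l \<in> H" "(\<lambda>n. ip_norm ip (\<sigma> n - l)) \<longlonglongrightarrow> 0"
proof -
  have "M.MCauchy \<sigma>"
    using assms by (auto simp: M.MCauchy_def ip_dist_def)
  then show ?thesis
    using mcomplete that by (auto simp: M.mcomplete_def limitin_iff)
qed

text \<open>This is how H_p, the closure of the polynomials, inherits completeness from
  L^2(nu_p).\<close>

lemma hilbert_closed_subspace:
  assumes "closed_subspace ip H W"
  shows "hilbert ip W"
proof -
  have W: "W \<subseteq> H" "complex_vector.subspace W" using assms by (auto simp: closed_subspace_def)
  interpret W: pre_hilbert ip W using W by (rule pre_hilbert_subspace)
  show ?thesis
  proof
    interpret Submetric H "ip_dist ip" W using W by unfold_locales
    show "W.M.mcomplete"
      using assms closedin_eq_mcomplete[OF mcomplete] by (simp add: closed_subspace_def ip_topology_eq)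
  qed
qed

text \<open>The classical nearest point argument: a minimizing sequence in \<open>W\<close> is
  Cauchy, its limit stays in \<open>W\<close>, and minimality of the distance is
  orthogonality.\<close>

lemma projection_exists:
  assumes W: "closed_subspace ip H W" and x: "x \<in> H"
  obtains y where "y \<in> W" "\<And>w. w \<in> W \<Longrightarrow> ip (x - y) w = 0"
proof -
  have W_H: "\<And>w. w \<in> W \<Longrightarrow> w \<in> H" and sub: "complex_vector.subspace W"
    and W_closed: "\<And>\<sigma> l. \<lbrakk>\<And>n. \<sigma> n \<in> W; l \<in> H; (\<lambda>n. ip_norm ip (\<sigma> n - l)) \<longlonglongrightarrow> 0\<rbrakk> \<Longrightarrow> l \<in> W"
    using W unfolding closed_subspace_iff by auto
  let ?D = "(\<lambda>w. (ip_norm ip (x - w))\<^sup>2) ` W"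
  define d where "d = Inf ?D"
  have ne: "?D \<noteq> {}" using complex_vector.subspace_0[OF sub] by auto
  have bdd: "bdd_below ?D" by (rule bdd_belowI2[of _ 0]) simp
  have d_le: "d \<le> (ip_norm ip (x - w))\<^sup>2" if "w \<in> W" for w
    unfolding d_def using that bdd by (intro cInf_lower) auto
  have "\<exists>y\<in>W. (ip_norm ip (x - y))\<^sup>2 < d + inverse (Suc n)" for n
    using cInf_lessD[OF ne, of "d + inverse (Suc n)"] by (auto simp: d_def)
  then obtain \<sigma> where \<sigma>: "\<And>n. \<sigma> n \<in> W" "\<And>n. (ip_norm ip (x - \<sigma> n))\<^sup>2 < d + inverse (Suc n)"
    by metis
  \<comment> \<open>The midpoint of two members of the sequence is again in \<open>W\<close>, so its
    squared distance to \<open>x\<close> is at least \<open>d\<close>; the parallelogram law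
    converts this into a bound on their mutual distance.\<close>
  have near: "(ip_norm ip (\<sigma> m - \<sigma> n))\<^sup>2 \<le> 2 * inverse (Suc m) + 2 * inverse (Suc n)" for m n
  proof -
    let ?c = "(1/2) *\<^sub>C (\<sigma> m + \<sigma> n)"
    have c: "?c \<in> W"
      using \<sigma>(1) sub by (simp add: complex_vector.subspace_add complex_vector.subspace_scale)
    have "(x - \<sigma> n) + (x - \<sigma> m) = 2 *\<^sub>C (x - ?c)"
      by (simp add: complex_vector.scale_right_diff_distrib scaleC_scaleC)
        (simp add: scaleC_add_left[of 1 1, simplified] scaleC_one)
    then have "(ip_norm ip ((x - \<sigma> n) + (x - \<sigma> m)))\<^sup>2 = 4 * (ip_norm ip (x - ?c))\<^sup>2"
      using x c W_H by (simp add: ip_norm_scale power_mult_distrib)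
    moreover have "(x - \<sigma> n) - (x - \<sigma> m) = \<sigma> m - \<sigma> n" by simp
    ultimately have "4 * (ip_norm ip (x - ?c))\<^sup>2 + (ip_norm ip (\<sigma> m - \<sigma> n))\<^sup>2
        = 2 * (ip_norm ip (x - \<sigma> n))\<^sup>2 + 2 * (ip_norm ip (x - \<sigma> m))\<^sup>2"
      using parallelogram[of "x - \<sigma> n" "x - \<sigma> m"] x \<sigma>(1) W_H by simp
    then show ?thesis using d_le[OF c] \<sigma>(2)[of m] \<sigma>(2)[of n] by linarith
  qed
  have "\<exists>N. \<forall>m\<ge>N. \<forall>n\<ge>N. ip_norm ip (\<sigma> m - \<sigma> n) < \<epsilon>" if "\<epsilon> > 0" for \<epsilon>
  proof -
    have "\<epsilon>\<^sup>2 / 4 > 0" using that by simp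
    then obtain N where N: "inverse (real (Suc N)) < \<epsilon>\<^sup>2 / 4"
      using reals_Archimedean by blast
    have "ip_norm ip (\<sigma> m - \<sigma> n) < \<epsilon>" if mn: "m \<ge> N" "n \<ge> N" for m n
    proof (rule power2_less_imp_less)
      have "inverse (real (Suc m)) \<le> inverse (real (Suc N))" "inverse (real (Suc n)) \<le> inverse (real (Suc N))"
        using mn by (auto simp: le_imp_inverse_le)
      then show "(ip_norm ip (\<sigma> m - \<sigma> n))\<^sup>2 < \<epsilon>\<^sup>2" using near[of m n] N by linarith
    qed (use \<open>\<epsilon> > 0\<close> in simp)
    then show ?thesis by blast
  qed
  then obtain y where y: "y \<in> H" "(\<lambda>n. ip_norm ip (\<sigma> n - y)) \<longlonglongrightarrow> 0"
    using Cauchy_convergent[of \<sigma>] \<sigma>(1) W_H by blast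
  have y_W: "y \<in> W" using W_closed[of \<sigma> y] \<sigma> y by blast
  have "(\<lambda>n. ip_norm ip (x - \<sigma> n)) \<longlonglongrightarrow> ip_norm ip (x - y)"
  proof (rule tendsto_ip_norm)
    show "(\<lambda>n. ip_norm ip ((x - \<sigma> n) - (x - y))) \<longlonglongrightarrow> 0"
      using y(2) ip_dist_commute[of y "\<sigma> _"] by (simp add: ip_dist_def)
  qed (use x y \<sigma> W_H in auto)
  then have "(\<lambda>n. (ip_norm ip (x - \<sigma> n))\<^sup>2) \<longlonglongrightarrow> (ip_norm ip (x - y))\<^sup>2"
    by (intro tendsto_power)
  moreover have "(\<lambda>n. d + inverse (real (Suc n))) \<longlonglongrightarrow> d"
    using LIMSEQ_inverse_real_of_nat_add by simp
  ultimately have le_d: "(ip_norm ip (x - y))\<^sup>2 \<le> d"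
    using \<sigma>(2) by (intro LIMSEQ_le[where Y = "\<lambda>n. d + inverse (real (Suc n))"]) (auto intro: less_imp_le)
  have "ip (x - y) w = 0" if w: "w \<in> W" for w
  proof (cases "w = 0")
    case False
    \<comment> \<open>With this coefficient, moving \<open>y\<close> by
      \<open>?t *\<^sub>C w\<close> lowers the squared distance to \<open>x\<close> by the square of
      |<x - y, w>| over that of |w|. Minimality allows no decrease, so the inner product is
      0.\<close>
    let ?t = "ip (x - y) w / ip w w"
    have "y + ?t *\<^sub>C w \<in> W"
      using y_W w sub by (simp add: complex_vector.subspace_add complex_vector.subspace_scale)
    from d_le[OF this] have "d \<le> (ip_norm ip (x - y - ?t *\<^sub>C w))\<^sup>2" by (simp add: diff_diff_eq)
    also have "\<dots> = (ip_norm ip (x - y))\<^sup>2 - (cmod (ip (x - y) w))\<^sup>2 / (ip_norm ip w)\<^sup>2"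
      using x y w W_H False by (intro ip_norm_diff_proj_sq) auto
    finally have "(cmod (ip (x - y) w))\<^sup>2 / (ip_norm ip w)\<^sup>2 \<le> 0" using le_d by linarith
    moreover have "(ip_norm ip w)\<^sup>2 > 0" using False w W_H by simp
    ultimately have "(cmod (ip (x - y) w))\<^sup>2 \<le> 0" by (simp add: divide_le_0_iff)
    then show ?thesis by simp
  qed (use x y in simp)
  with y_W show ?thesis by (rule that)
qed

end

lemma (in pre_hilbert) closed_subspace_closure:
  assumes V: "V \<subseteq> H" "complex_vector.subspace V"
  shows "closed_subspace ip H (M.mtopology closure_of V)"
proof -
  have seq: "x \<in> M.mtopology closure_of V \<longleftrightarrow>
      x \<in> H \<and> (\<exists>\<sigma>. (\<forall>n. \<sigma> n \<in> V) \<and> (\<lambda>n. ip_norm ip (\<sigma> n - x)) \<longlonglongrightarrow> 0)" for x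
  proof -
    have "limitin M.mtopology \<sigma> x sequentially \<longleftrightarrow> x \<in> H \<and> (\<lambda>n. ip_norm ip (\<sigma> n - x)) \<longlonglongrightarrow> 0"
      if "\<forall>n. \<sigma> n \<in> V" for \<sigma>
    proof -
      have "\<forall>n. \<sigma> n \<in> H" using that V by auto
      then show ?thesis by (simp add: limitin_iff)
    qed
    moreover have "V \<inter> H = V" using V by auto
    ultimately show ?thesis
      unfolding M.closure_of_sequentially by (auto simp: image_subset_iff)
  qed
  have "complex_vector.subspace (M.mtopology closure_of V)"
  proof (rule complex_vector.subspaceI)
    show "0 \<in> M.mtopology closure_of V"
      unfolding seq using complex_vector.subspace_0[OF V(2)] by (intro conjI exI[of _ "\<lambda>_. 0"]) auto
  next
    fix x y assume "x \<in> M.mtopology closure_of V" "y \<in> M.mtopology closure_of V"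
    then obtain \<sigma> \<tau> where \<sigma>: "x \<in> H" "\<And>n. \<sigma> n \<in> V" "(\<lambda>n. ip_norm ip (\<sigma> n - x)) \<longlonglongrightarrow> 0"
      and \<tau>: "y \<in> H" "\<And>n. \<tau> n \<in> V" "(\<lambda>n. ip_norm ip (\<tau> n - y)) \<longlonglongrightarrow> 0"
      unfolding seq by blast
    have in_H: "\<sigma> n \<in> H" "\<tau> n \<in> H" for n using \<sigma> \<tau> V by auto
    have lim: "(\<lambda>n. ip_norm ip (\<sigma> n + \<tau> n - (x + y))) \<longlonglongrightarrow> 0"
    proof (rule Lim_null_comparison)
      show "(\<lambda>n. ip_norm ip (\<sigma> n - x) + ip_norm ip (\<tau> n - y)) \<longlonglongrightarrow> 0"
        using tendsto_add[OF \<sigma>(3) \<tau>(3)] by simp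
      have "ip_norm ip (\<sigma> n + \<tau> n - (x + y)) \<le> ip_norm ip (\<sigma> n - x) + ip_norm ip (\<tau> n - y)" for n
        using ip_norm_triangle[of "\<sigma> n - x" "\<tau> n - y"] in_H[of n] \<sigma>(1) \<tau>(1) by (simp add: algebra_simps)
      then show "\<forall>\<^sub>F n in sequentially. norm (ip_norm ip (\<sigma> n + \<tau> n - (x + y)))
          \<le> ip_norm ip (\<sigma> n - x) + ip_norm ip (\<tau> n - y)" by simp
    qed
    show "x + y \<in> M.mtopology closure_of V"
      unfolding seq
    proof (intro conjI exI allI)
      show "\<sigma> n + \<tau> n \<in> V" for n using \<sigma>(2) \<tau>(2) V(2) by (simp add: complex_vector.subspace_add)
    qed (use lim \<sigma>(1) \<tau>(1) in simp_all)
  next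
    fix c x assume "x \<in> M.mtopology closure_of V"
    then obtain \<sigma> where \<sigma>: "x \<in> H" "\<And>n. \<sigma> n \<in> V" "(\<lambda>n. ip_norm ip (\<sigma> n - x)) \<longlonglongrightarrow> 0"
      unfolding seq by blast
    have in_H: "\<sigma> n \<in> H" for n using \<sigma> V by auto
    have lim: "(\<lambda>n. ip_norm ip (c *\<^sub>C \<sigma> n - c *\<^sub>C x)) \<longlonglongrightarrow> 0"
      using tendsto_mult_left[OF \<sigma>(3), of "cmod c"] in_H \<sigma>(1)
      by (simp add: ip_norm_scale flip: complex_vector.scale_right_diff_distrib)
    show "c *\<^sub>C x \<in> M.mtopology closure_of V"
      unfolding seq
    proof (intro conjI exI allI)
      show "c *\<^sub>C \<sigma> n \<in> V" for n using \<sigma>(2) V(2) by (simp add: complex_vector.subspace_scale)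
    qed (use lim \<sigma>(1) in simp_all)
  qed
  then show ?thesis
    using closure_of_subset_topspace[of M.mtopology V]
    by (simp add: closed_subspace_def ip_topology_eq)
qed

text \<open>Continuity carries invariance over to the closure. It yields invariance of H_p under the
  shifts from that of the polynomials.\<close>

lemma (in pre_hilbert) bounded_op_closure:
  assumes T: "bounded_op ip H T" and V: "V \<subseteq> H" "T ` V \<subseteq> V"
  shows "T ` (M.mtopology closure_of V) \<subseteq> M.mtopology closure_of V"
proof (rule image_subsetI)
  fix x assume "x \<in> M.mtopology closure_of V"
  then obtain \<sigma> where \<sigma>: "x \<in> H" "\<And>n. \<sigma> n \<in> V \<inter> H" "limitin M.mtopology \<sigma> x sequentially"
    unfolding M.closure_of_sequentially by blast
  then have "(\<lambda>n. ip_norm ip (T (\<sigma> n) - T x)) \<longlonglongrightarrow> 0"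
    by (intro tendsto_bounded_op[OF T]) (auto simp: limitin_iff)
  then have "limitin M.mtopology (\<lambda>n. T (\<sigma> n)) (T x) sequentially"
    using \<sigma> bounded_opD(1)[OF T] by (simp add: limitin_iff)
  moreover have "range (\<lambda>n. T (\<sigma> n)) \<subseteq> V \<inter> H" using \<sigma> V by auto
  ultimately show "T x \<in> M.mtopology closure_of V"
    unfolding M.closure_of_sequentially using \<sigma>(1) bounded_opD(1)[OF T] by blast
qed

section \<open>Compact self-adjoint operators\<close>

definition selfadjoint_op :: "'v::complex_vector inner_prod \<Rightarrow> 'v set \<Rightarrow> ('v \<Rightarrow> 'v) \<Rightarrow> bool" where
  "selfadjoint_op ip H T \<longleftrightarrow> bounded_op ip H T \<and> (\<forall>x\<in>H. \<forall>y\<in>H. ip (T x) y = ip x (T y))"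

definition projection_op :: "'v::complex_vector inner_prod \<Rightarrow> 'v set \<Rightarrow> ('v \<Rightarrow> 'v) \<Rightarrow> bool" where
  "projection_op ip H T \<longleftrightarrow> selfadjoint_op ip H T \<and> (\<forall>x\<in>H. T (T x) = T x)"

context pre_hilbert
begin

lemma subspace_eigenspace:
  assumes "bounded_op ip H T"
  shows "complex_vector.subspace (eigenspace H T \<mu>)"
  using bounded_opD[OF assms] subspace_H
  by (auto simp: eigenspace_def complex_vector.subspace_def scaleC_add_right scaleC_scaleC mult.commute)

lemma selfadjoint_eigenvalue_real:
  assumes "selfadjoint_op ip H T" "x \<in> H" "x \<noteq> 0" "T x = \<mu> *\<^sub>C x"
  shows "\<mu> \<in> \<real>"
proof -
  have "\<mu> * ip x x = ip (T x) x" using assms by (simp add: ip_linear)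
  also have "\<dots> = ip x (T x)" using assms(1,2) by (simp add: selfadjoint_op_def)
  also have "\<dots> = cnj \<mu> * ip x x" using assms by (simp add: ip_linear)
  finally have "\<mu> = cnj \<mu>" using assms ip_eq_0D by auto
  then show ?thesis by (simp add: Reals_cnj_iff)
qed

lemma projection_opD:
  assumes "projection_op ip H T"
  shows "bounded_op ip H T" "\<lbrakk>x \<in> H; y \<in> H\<rbrakk> \<Longrightarrow> ip (T x) y = ip x (T y)" "x \<in> H \<Longrightarrow> T (T x) = T x"
    "x \<in> H \<Longrightarrow> T x \<in> H"
  using assms bounded_opD(1)[of T x] by (auto simp: projection_op_def selfadjoint_op_def)

text \<open>By idempotence and symmetry <T x, x> = <T x, T x>. A vanishing sum of such forms is a
  vanishing sum of squares, which is how the endpoint eigenspaces are found.\<close>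

lemma projection_ip_self:
  assumes "projection_op ip H T" "x \<in> H"
  shows "ip (T x) x = complex_of_real ((ip_norm ip (T x))\<^sup>2)"
  using projection_opD(2)[OF assms(1), of "T x" x] projection_opD[OF assms(1)] assms(2)
  by (simp add: ip_self)

lemma projection_norm_le:
  assumes "projection_op ip H T" "x \<in> H"
  shows "ip_norm ip (T x) \<le> ip_norm ip x"
proof (cases "ip_norm ip (T x) = 0")
  case False
  have "(ip_norm ip (T x))\<^sup>2 = cmod (ip (T x) x)"
    using projection_ip_self[OF assms] by (simp add: norm_power)
  also have "\<dots> \<le> ip_norm ip (T x) * ip_norm ip x"
    using cauchy_schwarz projection_opD(4)[OF assms] assms(2) by blast
  finally show ?thesis using False by (simp add: power2_eq_square less_le)
qed simp

lemma projection_complement: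
  assumes "projection_op ip H T"
  shows "projection_op ip H (\<lambda>x. x - T x)"
  using projection_opD[OF assms] bounded_op_diff[OF bounded_op_id projection_opD(1)[OF assms]]
  by (auto simp: projection_op_def selfadjoint_op_def ip_linear bounded_opD)

lemma projection_add:
  assumes S: "projection_op ip H S" and T: "projection_op ip H T"
    and "\<And>x. x \<in> H \<Longrightarrow> S (T x) = 0" "\<And>x. x \<in> H \<Longrightarrow> T (S x) = 0"
  shows "projection_op ip H (\<lambda>x. S x + T x)"
  using projection_opD[OF S] projection_opD[OF T] assms
    bounded_op_add[OF projection_opD(1)[OF S] projection_opD(1)[OF T]]
  by (auto simp: projection_op_def selfadjoint_op_def ip_linear bounded_opD)

lemma projection_eigenvalue:
  assumes "projection_op ip H T" "x \<in> H" "x \<noteq> 0" "T x = \<mu> *\<^sub>C x"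
  shows "\<mu> = 0 \<or> \<mu> = 1"
proof -
  have "T (T x) = (\<mu> * \<mu>) *\<^sub>C x"
    using assms projection_opD(1)[OF assms(1)] by (simp add: bounded_opD scaleC_scaleC)
  then have "(\<mu> * \<mu> - \<mu>) *\<^sub>C x = 0"
    using projection_opD(3)[OF assms(1,2)] assms(4) by (simp add: complex_vector.scale_left_diff_distrib)
  then have "\<mu> * (\<mu> - 1) = 0"
    using assms(3) by (simp add: right_diff_distrib)
  then show ?thesis by simp
qed

section \<open>Orthonormal sets and finite dimension\<close>

text \<open>Additivity of \<open>ip\<close> is available only on \<open>H\<close>, so membership of
  the partial sums has to run through the same induction.\<close>

lemma ip_sum_left:
  assumes "finite F" "\<And>v. v \<in> F \<Longrightarrow> g v \<in> H" "y \<in> H"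
  shows "ip (\<Sum>v\<in>F. g v) y = (\<Sum>v\<in>F. ip (g v) y) \<and> (\<Sum>v\<in>F. g v) \<in> H"
  using assms by (induction F rule: finite_induct) (auto simp: ip_linear)

definition orthonormal_set :: "'v set \<Rightarrow> bool" where
  "orthonormal_set F \<longleftrightarrow> F \<subseteq> H \<and> (\<forall>v\<in>F. \<forall>w\<in>F. ip v w = (if v = w then 1 else 0))"

lemma orthonormal_coeff:
  assumes "orthonormal_set F" "finite F" "w \<in> F"
  shows "ip (\<Sum>v\<in>F. c v *\<^sub>C v) w = c w"
proof -
  have "ip (\<Sum>v\<in>F. c v *\<^sub>C v) w = (\<Sum>v\<in>F. ip (c v *\<^sub>C v) w)"
    using assms by (intro ip_sum_left[THEN conjunct1]) (auto simp: orthonormal_set_def)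
  also have "\<dots> = (\<Sum>v\<in>F. if v = w then c w else 0)"
    using assms by (intro sum.cong) (auto simp: orthonormal_set_def ip_linear subset_iff)
  finally show ?thesis using assms by simp
qed

lemma orthonormal_independent:
  assumes "orthonormal_set F" "finite F"
  shows "complex_vector.independent F"
  unfolding complex_vector.dependent_finite[OF assms(2)]
proof
  assume "\<exists>c. (\<exists>v\<in>F. c v \<noteq> 0) \<and> (\<Sum>v\<in>F. c v *\<^sub>C v) = 0"
  then obtain c w where c: "w \<in> F" "c w \<noteq> 0" "(\<Sum>v\<in>F. c v *\<^sub>C v) = 0" by blast
  then show False
    using orthonormal_coeff[OF assms c(1), of c] assms(1) by (auto simp: orthonormal_set_def subset_iff)
qed

text \<open>An orthonormal subset of \<open>W\<close> of largest size must span \<open>W\<close>,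
  since a Gram-Schmidt step on a vector outside the span would enlarge it.\<close>

lemma has_dim_if_orthonormal_card_le:
  assumes W: "W \<subseteq> H" "complex_vector.subspace W"
    and bound: "\<And>F. \<lbrakk>finite F; orthonormal_set F; F \<subseteq> W\<rbrakk> \<Longrightarrow> card F \<le> N"
  shows "\<exists>m. has_dim W m"
proof -
  let ?P = "\<lambda>n. \<exists>F. finite F \<and> orthonormal_set F \<and> F \<subseteq> W \<and> card F = n"
  have "?P 0" by (intro exI[of _ "{}"]) (simp add: orthonormal_set_def)
  then obtain n where n: "?P n" "\<And>k. ?P k \<Longrightarrow> k \<le> n"
    using GreatestI_nat[of ?P 0 N] Greatest_le_nat[of ?P _ N] bound by blast
  then obtain F where F: "finite F" "orthonormal_set F" "F \<subseteq> W" "card F = n" by blast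
  have F_H: "\<And>v. v \<in> F \<Longrightarrow> v \<in> H" using F by (auto simp: orthonormal_set_def)
  have "complex_vector.span F = W"
  proof
    show "complex_vector.span F \<subseteq> W" using F W by (intro complex_vector.span_minimal)
    show "W \<subseteq> complex_vector.span F"
    proof (rule ccontr)
      assume "\<not> W \<subseteq> complex_vector.span F"
      then obtain w where w: "w \<in> W" "w \<notin> complex_vector.span F" by blast
      \<comment> \<open>The orthogonal projection of \<open>w\<close> onto the span of
        \<open>F\<close>; the normalized remainder \<open>e\<close> is the vector that could be
        added to \<open>F\<close>.\<close>
      define s where "s = (\<Sum>v\<in>F. ip w v *\<^sub>C v)"
      define u where "u = w - s"
      have s: "s \<in> complex_vector.span F"
        unfolding s_def
        by (intro complex_vector.span_sum complex_vector.span_scale complex_vector.span_base)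
      then have sW: "s \<in> W" using complex_vector.span_minimal[OF F(3) W(2)] by blast
      have u: "u \<in> W" "u \<noteq> 0" "u \<in> H"
        using w s sW W complex_vector.subspace_diff[OF W(2)] by (auto simp: u_def)
      have ortho: "ip u v = 0" "ip v u = 0" if "v \<in> F" for v
      proof -
        have "ip s v = ip w v" unfolding s_def by (rule orthonormal_coeff[OF F(2,1) that])
        moreover have "w \<in> H" "s \<in> H" "v \<in> H" using w sW W(1) that F_H by auto
        ultimately show "ip u v = 0" by (simp add: u_def ip_linear)
        then show "ip v u = 0" using ip_commute[of u v] u that F_H by simp
      qed
      define e where "e = complex_of_real (inverse (ip_norm ip u)) *\<^sub>C u"
      have e: "e \<in> W" "e \<in> H" using u complex_vector.subspace_scale[OF W(2)] W by (auto simp: e_def)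
      have ee: "ip e e = 1"
        using u by (simp add: e_def ip_self ip_norm_scale norm_inverse)
      have ev: "ip e v = 0" "ip v e = 0" if "v \<in> F" for v
        using ortho[OF that] u F_H[OF that] by (simp_all add: e_def ip_linear)
      have "e \<notin> F" using ev ee by force
      moreover have "orthonormal_set (insert e F)"
        using F(2) e ee ev \<open>e \<notin> F\<close> by (auto simp: orthonormal_set_def)
      ultimately have "?P (Suc n)" using F e by (intro exI[of _ "insert e F"]) auto
      then have "Suc n \<le> n" by (rule n(2))
      then show False by simp
    qed
  qed
  then show ?thesis
    using F orthonormal_independent by (auto simp: has_dim_def)
qed

end

text \<open>\<open>f\<close> is linear only on \<open>V\<close>, while the vector space theorems
  speak of maps linear on the whole type. A globally linear \<open>g\<close> that agrees with
  \<open>f\<close> on a basis, hence on \<open>V\<close>, takes its place.\<close>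

lemma has_dim_linear_image:
  fixes f :: "'v::complex_vector \<Rightarrow> 'v"
  assumes dim: "has_dim V m" and inj: "inj_on f V"
    and add: "\<And>x y. \<lbrakk>x \<in> V; y \<in> V\<rbrakk> \<Longrightarrow> f (x + y) = f x + f y"
    and scale: "\<And>c x. x \<in> V \<Longrightarrow> f (c *\<^sub>C x) = c *\<^sub>C f x"
  shows "has_dim (f ` V) m"
proof -
  interpret P: vector_space_pair "scaleC :: complex \<Rightarrow> 'v \<Rightarrow> 'v" "scaleC :: complex \<Rightarrow> 'v \<Rightarrow> 'v" ..
  obtain B where B: "finite B" "card B = m" "complex_vector.independent B" "complex_vector.span B = V"
    using dim by (auto simp: has_dim_def)
  obtain g where g: "Vector_Spaces.linear scaleC scaleC g" "\<And>x. x \<in> B \<Longrightarrow> g x = f x"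
    using P.linear_independent_extend[OF B(3)] by blast
  have f0: "f 0 = 0"
    using scale[of 0 0] complex_vector.span_zero[of B] B(4) by simp
  have "x \<in> V \<and> g x = f x" if "x \<in> complex_vector.span B" for x
    using that
  proof (induction rule: complex_vector.span_induct_alt)
    case base
    show ?case using f0 P.linear_0[OF g(1)] B(4) complex_vector.span_zero[of B] by simp
  next
    case (step c x y)
    then have "x \<in> V" "c *\<^sub>C x \<in> V" "c *\<^sub>C x + y \<in> V"
      using B(4) complex_vector.span_base[of x B] complex_vector.span_scale[of x B c]
        complex_vector.span_add[of "c *\<^sub>C x" B y] by auto
    then show ?case
      using g step add[of "c *\<^sub>C x" y] scale[of x c] by (simp add: P.linear_add P.linear_scale)
  qed
  then have eq: "g x = f x" if "x \<in> complex_vector.span B" for x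
    using that by blast
  have inj_g: "inj_on g (complex_vector.span B)"
    using inj eq B(4) by (auto simp: inj_on_def)
  have "complex_vector.independent (g ` B)"
    using P.linear_independent_injective_image[OF g(1) B(3) inj_g] .
  moreover have "complex_vector.span (g ` B) = f ` V"
    using P.linear_span_image[OF g(1), of B] eq B(4) by auto
  moreover have "card (g ` B) = m"
    using B inj_on_subset[OF inj_g complex_vector.span_superset] by (simp add: card_image)
  ultimately show ?thesis using B(1) unfolding has_dim_def by blast
qed

text \<open>The equivalence is what the multiplicities need: the dimension known for the singular
  eigenspace, the target of \<open>E\<close>, must be pulled back to the eigenspace of
  \<open>C\<close>. The inverse is again linear on its domain.\<close>

lemma has_dim_linear_bij:
  fixes f :: "'v::complex_vector \<Rightarrow> 'v"
  assumes V: "complex_vector.subspace V" and bij: "bij_betw f V W"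
    and add: "\<And>x y. \<lbrakk>x \<in> V; y \<in> V\<rbrakk> \<Longrightarrow> f (x + y) = f x + f y"
    and scale: "\<And>c x. x \<in> V \<Longrightarrow> f (c *\<^sub>C x) = c *\<^sub>C f x"
  shows "has_dim V m \<longleftrightarrow> has_dim W m"
proof
  have W: "f ` V = W" and inj: "inj_on f V" using bij by (auto simp: bij_betw_def)
  show "has_dim V m \<Longrightarrow> has_dim W m"
    using has_dim_linear_image[OF _ inj add scale] W by simp
  assume dim: "has_dim W m"
  let ?g = "inv_into V f"
  have g: "?g y \<in> V" "f (?g y) = y" if "y \<in> W" for y
    using that W by (auto intro: inv_into_into f_inv_into_f)
  have gI: "?g y = x" if "x \<in> V" "f x = y" for x y
    using that inj by (auto intro: inv_into_f_eq)
  have "has_dim (?g ` W) m"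
  proof (rule has_dim_linear_image[OF dim])
    show "inj_on ?g W" using W by (auto intro: inj_on_inv_into)
    show "?g (y + z) = ?g y + ?g z" if "y \<in> W" "z \<in> W" for y z
      using that g V by (intro gI) (auto simp: complex_vector.subspace_add add)
    show "?g (c *\<^sub>C y) = c *\<^sub>C ?g y" if "y \<in> W" for c y
      using that g V by (intro gI) (auto simp: complex_vector.subspace_scale scale)
  qed
  then show "has_dim V m" using bij_betw_inv_into[OF bij] by (simp add: bij_betw_def)
qed

lemma has_dim_pos_iff:
  assumes "has_dim W m"
  shows "0 < m \<longleftrightarrow> W \<noteq> {0}"
proof -
  obtain B where B: "finite B" "card B = m" "complex_vector.independent B" "complex_vector.span B = W"
    using assms by (auto simp: has_dim_def)
  show ?thesis
  proof (cases "B = {}")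
    case False
    then obtain b where b: "b \<in> B" by blast
    then have "b \<noteq> 0" "b \<in> W" "0 < m"
      using B complex_vector.dependent_zero[of B] complex_vector.span_base[OF b]
      by (auto simp: card_gt_0_iff)
    then show ?thesis by blast
  qed (use B in auto)
qed

section \<open>Compact operators: eigenspaces and spectrum\<close>

context hilbert
begin

text \<open>The lower bound turns a convergent sequence of images into a Cauchy sequence of
  preimages, whose limit is mapped to the limit of the images. Used for isometries with
  \<open>c = 1\<close> and for T - \<mu> away from eigenvalues.\<close>

lemma closed_range_if_bounded_below:
  assumes T: "bounded_op ip H T" and c: "c > 0" "\<And>x. x \<in> H \<Longrightarrow> c * ip_norm ip x \<le> ip_norm ip (T x)"
  shows "closed_subspace ip H (T ` H)"
  unfolding closed_subspace_iff
proof (intro conjI allI impI)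
  show "T ` H \<subseteq> H" using bounded_opD(1)[OF T] by auto
  show "complex_vector.subspace (T ` H)"
  proof (rule complex_vector.subspaceI)
    show "0 \<in> T ` H" using bounded_opD(4)[OF T] by (intro image_eqI[of _ _ 0]) auto
    show "x + y \<in> T ` H" if "x \<in> T ` H" "y \<in> T ` H" for x y
      using that bounded_opD(2)[OF T, symmetric] by auto
    show "a *\<^sub>C x \<in> T ` H" if "x \<in> T ` H" for a x
      using that bounded_opD(3)[OF T, symmetric] by auto
  qed
  fix \<sigma> l assume "\<forall>n. \<sigma> n \<in> T ` H" and l: "l \<in> H" and lim: "(\<lambda>n. ip_norm ip (\<sigma> n - l)) \<longlonglongrightarrow> 0"
  then have "\<forall>n. \<exists>x. x \<in> H \<and> \<sigma> n = T x" by blast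
  then obtain \<tau> where \<tau>: "\<And>n. \<tau> n \<in> H" "\<And>n. \<sigma> n = T (\<tau> n)" by metis
  have \<sigma>: "\<sigma> n \<in> H" for n using \<tau> T by (simp add: bounded_opD)
  have "\<exists>N. \<forall>m\<ge>N. \<forall>n\<ge>N. ip_norm ip (\<tau> m - \<tau> n) < \<epsilon>" if "\<epsilon> > 0" for \<epsilon>
  proof -
    have "c * \<epsilon> / 2 > 0" using that c by simp
    from LIMSEQ_D[OF lim this] obtain N where N: "\<And>n. n \<ge> N \<Longrightarrow> ip_norm ip (\<sigma> n - l) < c * \<epsilon> / 2"
      by auto
    have "ip_norm ip (\<tau> m - \<tau> n) < \<epsilon>" if mn: "m \<ge> N" "n \<ge> N" for m n
    proof -
      have "c * ip_norm ip (\<tau> m - \<tau> n) \<le> ip_norm ip (\<sigma> m - \<sigma> n)"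
        using c(2)[of "\<tau> m - \<tau> n"] \<tau> T by (simp add: bounded_opD)
      also have "\<dots> \<le> ip_norm ip (\<sigma> m - l) + ip_norm ip (\<sigma> n - l)"
        using M.triangle[of "\<sigma> m" l "\<sigma> n"] \<sigma> l ip_dist_commute[of l "\<sigma> n"] by (simp add: ip_dist_def)
      also have "\<dots> < c * \<epsilon>" using N[OF mn(1)] N[OF mn(2)] by simp
      finally show ?thesis using c by simp
    qed
    then show ?thesis by blast
  qed
  then obtain t where t: "t \<in> H" "(\<lambda>n. ip_norm ip (\<tau> n - t)) \<longlonglongrightarrow> 0"
    using Cauchy_convergent[of \<tau>] \<tau>(1) by blast
  have "(\<lambda>n. ip_norm ip (\<sigma> n - T t)) \<longlonglongrightarrow> 0"
    using tendsto_bounded_op[OF T \<tau>(1) t] \<tau>(2) by simp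
  then have "l = T t" using limit_unique[of \<sigma> l "T t"] \<sigma> l lim t T by (simp add: bounded_opD)
  then show "l \<in> T ` H" using t by blast
qed

lemma compact_op_subsequence:
  fixes \<sigma> :: "nat \<Rightarrow> 'v"
  assumes T: "compact_op ip H T" and \<sigma>: "\<And>n. \<sigma> n \<in> H" "\<And>n. ip_norm ip (\<sigma> n) \<le> 1"
  obtains l r where "l \<in> H" "strict_mono r" "(\<lambda>n. ip_norm ip (T (\<sigma> (r n)) - l)) \<longlonglongrightarrow> 0"
proof -
  let ?I = "T ` {x \<in> H. ip_norm ip x \<le> 1}"
  have "?I \<subseteq> H" using T bounded_opD(1) by (auto simp: compact_op_def)
  then have "?I \<subseteq> M.mtopology closure_of ?I" by (intro closure_of_subset) simp
  then have "range (\<lambda>n. T (\<sigma> n)) \<subseteq> M.mtopology closure_of ?I" using \<sigma> by blast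
  moreover have "compactin M.mtopology (M.mtopology closure_of ?I)"
    using T by (simp add: compact_op_def ip_topology_eq)
  ultimately obtain l r where lr: "strict_mono r" "limitin M.mtopology ((\<lambda>n. T (\<sigma> n)) \<circ> r) l sequentially"
    unfolding M.compactin_sequentially by blast
  then have "l \<in> H" "(\<lambda>n. ip_norm ip (T (\<sigma> (r n)) - l)) \<longlonglongrightarrow> 0"
    by (simp_all add: limitin_iff)
  then show ?thesis using lr(1) by (intro that)
qed

text \<open>For orthonormal eigenvectors \<open>v\<close> the images
  \<open>\<mu> *\<^sub>C v\<close> lie in a totally bounded set at mutual distance sqrt 2 |\<mu>|. A
  finite cover by balls of radius |\<mu>|/2 therefore bounds their number.\<close>

lemma compact_op_eigenspace_has_dim:
  assumes T: "compact_op ip H T" and \<mu>: "\<mu> \<noteq> 0"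
  shows "\<exists>m. has_dim (eigenspace H T \<mu>) m"
proof -
  let ?I = "T ` {x \<in> H. ip_norm ip x \<le> 1}"
  have bdd: "bounded_op ip H T" using T by (simp add: compact_op_def)
  have "?I \<subseteq> H" using bdd bounded_opD(1) by auto
  then have sub: "?I \<subseteq> M.mtopology closure_of ?I" by (intro closure_of_subset) simp
  have "M.mtotally_bounded (M.mtopology closure_of ?I)"
    using T by (intro M.compactin_imp_mtotally_bounded) (simp add: compact_op_def ip_topology_eq)
  moreover have "cmod \<mu> / 2 > 0" using \<mu> by simp
  ultimately obtain K where K: "finite K" "M.mtopology closure_of ?I \<subseteq> (\<Union>x\<in>K. M.mball x (cmod \<mu> / 2))"
    unfolding M.mtotally_bounded_def by meson
  have "card F \<le> card K" if F: "finite F" "orthonormal_set F" "F \<subseteq> eigenspace H T \<mu>" for F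
  proof -
    have F_H: "v \<in> H" "T v = \<mu> *\<^sub>C v" "ip_norm ip v = 1" if "v \<in> F" for v
      using that F by (auto simp: eigenspace_def orthonormal_set_def ip_norm_def)
    have "\<exists>x\<in>K. \<mu> *\<^sub>C v \<in> M.mball x (cmod \<mu> / 2)" if "v \<in> F" for v
    proof -
      have "T v \<in> ?I" using F_H[OF that] by (intro imageI) simp
      then have "\<mu> *\<^sub>C v \<in> M.mtopology closure_of ?I" using sub F_H(2)[OF that] by auto
      then show ?thesis using subsetD[OF K(2)] by blast
    qed
    then obtain k where k: "\<And>v. v \<in> F \<Longrightarrow> k v \<in> K" "\<And>v. v \<in> F \<Longrightarrow> \<mu> *\<^sub>C v \<in> M.mball (k v) (cmod \<mu> / 2)"
      by metis
    have "inj_on k F"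
    proof (rule inj_onI, rule ccontr)
      fix v w assume vw: "v \<in> F" "w \<in> F" "k v = k w" "v \<noteq> w"
      \<comment> \<open>Two points of one ball are less than |\<mu>| apart, so \<open>v\<close> and
        \<open>w\<close> would be at distance below 1, although orthonormal vectors are at distance
        sqrt 2.\<close>
      have "ip_dist ip (\<mu> *\<^sub>C v) (\<mu> *\<^sub>C w) < cmod \<mu> / 2 + cmod \<mu> / 2"
        using k(2)[OF vw(1)] k(2)[OF vw(2)] vw(3) M.triangle[of "\<mu> *\<^sub>C v" "k v" "\<mu> *\<^sub>C w"]
          ip_dist_commute[of "\<mu> *\<^sub>C v" "k v"]
        by auto
      moreover have "ip_dist ip (\<mu> *\<^sub>C v) (\<mu> *\<^sub>C w) = cmod \<mu> * ip_norm ip (v - w)"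
        using F_H vw by (simp add: ip_dist_def ip_norm_scale flip: complex_vector.scale_right_diff_distrib)
      ultimately have "ip_norm ip (v - w) < 1" using \<mu> by simp
      moreover have "(ip_norm ip (v - w))\<^sup>2 = 2"
        using F_H vw F(2) by (simp add: ip_norm_diff_sq orthonormal_set_def)
      ultimately show False using power_le_one[of "ip_norm ip (v - w)" 2] by simp
    qed
    then show ?thesis using k(1) K(1) by (intro card_inj_on_le[of k]) auto
  qed
  then show ?thesis
    using subspace_eigenspace[OF bdd]
    by (intro has_dim_if_orthonormal_card_le) (auto simp: eigenspace_def)
qed

text \<open>Otherwise there are unit vectors u with T u - \<mu> u tending to 0. Along a subsequence
  T u converges to some l, hence so does \<mu> u. By continuity T l = \<mu> l, and |l| = |\<mu>| > 0
  contradicts the trivial eigenspace.\<close>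

lemma compact_op_bounded_below:
  assumes T: "compact_op ip H T" and \<mu>: "\<mu> \<noteq> 0" "eigenspace H T \<mu> = {0}"
  shows "\<exists>c>0. \<forall>x\<in>H. c * ip_norm ip x \<le> ip_norm ip (T x - \<mu> *\<^sub>C x)"
proof (rule ccontr)
  assume not: "\<not> ?thesis"
  have bdd: "bounded_op ip H T" using T by (simp add: compact_op_def)
  have "\<exists>u\<in>H. ip_norm ip u = 1 \<and> ip_norm ip (T u - \<mu> *\<^sub>C u) < inverse (Suc n)" for n
  proof -
    obtain x where x: "x \<in> H" "ip_norm ip (T x - \<mu> *\<^sub>C x) < inverse (Suc n) * ip_norm ip x"
      using not by (metis inverse_positive_iff_positive not_le of_nat_0_less_iff zero_less_Suc)
    have "x \<noteq> 0" using x bdd by (auto simp: bounded_opD)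
    then have pos: "ip_norm ip x > 0" using x by (simp add: less_le)
    define u where "u = complex_of_real (inverse (ip_norm ip x)) *\<^sub>C x"
    have "T u - \<mu> *\<^sub>C u = complex_of_real (inverse (ip_norm ip x)) *\<^sub>C (T x - \<mu> *\<^sub>C x)"
      using x bdd unfolding u_def
      by (simp add: bounded_opD scaleC_scaleC complex_vector.scale_right_diff_distrib mult.commute)
    then have "ip_norm ip (T u - \<mu> *\<^sub>C u) = inverse (ip_norm ip x) * ip_norm ip (T x - \<mu> *\<^sub>C x)"
      using x bdd pos by (simp add: ip_norm_scale bounded_opD norm_inverse)
    moreover have "\<dots> < inverse (Suc n)" using x pos by (simp add: field_simps)
    moreover have "ip_norm ip u = 1" using x(1) pos by (simp add: u_def ip_norm_scale norm_inverse del: ip_norm_eq_0)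
    moreover have "u \<in> H" using x by (simp add: u_def)
    ultimately show ?thesis by auto
  qed
  then obtain u where u: "\<And>n. u n \<in> H" "\<And>n. ip_norm ip (u n) = 1"
    "\<And>n. ip_norm ip (T (u n) - \<mu> *\<^sub>C u n) < inverse (Suc n)"
    by metis
  obtain l r where l: "l \<in> H" and r: "strict_mono r"
    and lim: "(\<lambda>n. ip_norm ip (T (u (r n)) - l)) \<longlonglongrightarrow> 0"
    using compact_op_subsequence[OF T, of u] u by auto
  let ?v = "\<lambda>n. \<mu> *\<^sub>C u (r n)"
  have v: "?v n \<in> H" and Tu: "T (u n) \<in> H" for n using u bdd by (simp_all add: bounded_opD)
  have small: "(\<lambda>n. inverse (real (Suc (r n)))) \<longlonglongrightarrow> 0"
    using LIMSEQ_subseq_LIMSEQ[OF LIMSEQ_inverse_real_of_nat r] by (simp add: comp_def)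
  have v_lim: "(\<lambda>n. ip_norm ip (?v n - l)) \<longlonglongrightarrow> 0"
  proof (rule Lim_null_comparison)
    show "(\<lambda>n. inverse (real (Suc (r n))) + ip_norm ip (T (u (r n)) - l)) \<longlonglongrightarrow> 0"
      using tendsto_add[OF small lim] by simp
    have "ip_norm ip (?v n - l) \<le> inverse (real (Suc (r n))) + ip_norm ip (T (u (r n)) - l)" for n
      using M.triangle[of "?v n" "T (u (r n))" l] v Tu l u(3)[of "r n"]
        ip_dist_commute[of "?v n" "T (u (r n))"]
      by (simp add: ip_dist_def)
    then show "\<forall>\<^sub>F n in sequentially. norm (ip_norm ip (?v n - l))
        \<le> inverse (real (Suc (r n))) + ip_norm ip (T (u (r n)) - l)" by simp
  qed
  have "(\<lambda>n. ip_norm ip (T (?v n) - \<mu> *\<^sub>C l)) \<longlonglongrightarrow> 0"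
  proof -
    have "T (?v n) - \<mu> *\<^sub>C l = \<mu> *\<^sub>C (T (u (r n)) - l)" for n
      using u bdd by (simp add: bounded_opD complex_vector.scale_right_diff_distrib)
    then show ?thesis
      using tendsto_mult_left[OF lim, of "cmod \<mu>"] Tu l by (simp add: ip_norm_scale)
  qed
  then have "T l = \<mu> *\<^sub>C l"
    using limit_unique[of "\<lambda>n. T (?v n)" "T l" "\<mu> *\<^sub>C l"] tendsto_bounded_op[OF bdd v l v_lim] v l bdd
    by (simp add: bounded_opD)
  then have "l = 0" using l \<mu>(2) by (auto simp: eigenspace_def set_eq_iff)
  moreover have "ip_norm ip l = cmod \<mu>"
    using tendsto_ip_norm[OF v l v_lim] u by (simp add: ip_norm_scale LIMSEQ_const_iff)
  ultimately show False using \<mu>(1) by simp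
qed

text \<open>The Fredholm alternative in the self-adjoint case. If \<mu> is not an eigenvalue, T -
  \<mu> is bounded below, hence injective with closed range; surjectivity then follows from the
  reality of eigenvalues.\<close>

lemma op_spectrum_compact_selfadjoint:
  assumes T: "compact_op ip H T" and sa: "selfadjoint_op ip H T"
  shows "op_spectrum ip H T - {0} = {\<mu>. \<mu> \<noteq> 0 \<and> eigenspace H T \<mu> \<noteq> {0}}"
proof -
  have bdd: "bounded_op ip H T" using T by (simp add: compact_op_def)
  have eig: "\<mu> \<in> op_spectrum ip H T" if "eigenspace H T \<mu> \<noteq> {0}" for \<mu>
  proof -
    have "0 \<in> eigenspace H T \<mu>" using bdd by (simp add: eigenspace_def bounded_opD)
    then have "\<not> eigenspace H T \<mu> \<subseteq> {0}" using that by (auto intro: subset_antisym)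
    then obtain x where "x \<in> eigenspace H T \<mu>" "x \<noteq> 0" by (auto simp: subset_iff)
    then have x: "x \<in> H" "T x = \<mu> *\<^sub>C x" "x \<noteq> 0" by (simp_all add: eigenspace_def)
    show ?thesis
      unfolding op_spectrum_def
    proof (intro CollectI notI, elim exE conjE)
      fix R assume R: "bounded_op ip H R"
        "\<forall>x\<in>H. R (T x - \<mu> *\<^sub>C x) = x \<and> T (R x) - \<mu> *\<^sub>C R x = x"
      \<comment> \<open>T x - \<mu> x is 0, so a left inverse would have to send 0 to the
        eigenvector.\<close>
      then have "x = R 0" using x by force
      then show False using bounded_opD(4)[OF R(1)] x by simp
    qed
  qed
  have "\<mu> \<notin> op_spectrum ip H T" if \<mu>: "\<mu> \<noteq> 0" "eigenspace H T \<mu> = {0}" for \<mu>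
  proof -
    define D where "D x = T x - \<mu> *\<^sub>C x" for x
    have D: "bounded_op ip H D"
      unfolding D_def by (intro bounded_op_diff bdd bounded_op_scale bounded_op_id)
    obtain c where c: "c > 0" "\<And>x. x \<in> H \<Longrightarrow> c * ip_norm ip x \<le> ip_norm ip (D x)"
      using compact_op_bounded_below[OF T \<mu>] unfolding D_def by blast
    have inj: "x = y" if "x \<in> H" "y \<in> H" "D x = D y" for x y
    proof -
      have "c * ip_norm ip (x - y) \<le> 0" using c(2)[of "x - y"] that D by (simp add: bounded_opD)
      then have "ip_norm ip (x - y) = 0"
        using c(1) ip_norm_ge_0[of "x - y"] by (simp add: mult_le_0_iff)
      then show ?thesis using that by simp
    qed
    have surj: "\<exists>x\<in>H. D x = y" if y: "y \<in> H" for y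
    proof -
      obtain y' where y': "y' \<in> D ` H" "\<And>w. w \<in> D ` H \<Longrightarrow> ip (y - y') w = 0"
        using projection_exists[OF closed_range_if_bounded_below[OF D c] y] by blast
      \<comment> \<open>Being orthogonal to the range of \<open>D\<close>, \<open>z\<close>
        satisfies T z = cnj \<mu> z. If it were non-zero, cnj \<mu> would be real, hence equal to
        \<mu>, making \<mu> an eigenvalue. So \<open>y\<close> equals \<open>y'\<close> and lies in
        the range.\<close>
      define z where "z = y - y'"
      have z: "z \<in> H" using y y' D by (auto simp: z_def bounded_opD)
      have "ip x (T z) = ip x (cnj \<mu> *\<^sub>C z)" if x: "x \<in> H" for x
      proof -
        have "ip z (T x - \<mu> *\<^sub>C x) = 0" using y'(2)[of "D x"] x by (simp add: z_def D_def)
        then have "ip (T x) z = \<mu> * ip x z"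
          using x z bdd ip_eq_0_commute[of z "T x - \<mu> *\<^sub>C x"] by (simp add: ip_linear bounded_opD)
        moreover have "ip (T x) z = ip x (T z)" using sa x z by (simp add: selfadjoint_op_def)
        ultimately show ?thesis using x z by (simp add: ip_linear)
      qed
      then have Tz: "T z = cnj \<mu> *\<^sub>C z"
        using z bdd by (intro ip_cancel) (auto simp: bounded_opD)
      have "z = 0"
      proof (rule ccontr)
        assume "z \<noteq> 0"
        then have "cnj \<mu> \<in> \<real>" using selfadjoint_eigenvalue_real[OF sa z _ Tz] by simp
        then have "cnj \<mu> = \<mu>" by (simp add: Reals_cnj_iff)
        then show False using Tz z \<mu> \<open>z \<noteq> 0\<close> by (auto simp: eigenspace_def)
      qed
      then show ?thesis using y'(1) by (auto simp: z_def)
    qed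
    define R where "R = inv_into H D"
    have R: "R y \<in> H" "D (R y) = y" if "y \<in> H" for y
    proof -
      have "y \<in> D ` H" using surj[OF that] by blast
      then show "R y \<in> H" "D (R y) = y" by (simp_all add: R_def inv_into_into f_inv_into_f)
    qed
    have R_D: "R (D x) = x" if "x \<in> H" for x
    proof (rule inj)
      show "R (D x) \<in> H" "x \<in> H" "D (R (D x)) = D x"
        using that R[of "D x"] bounded_opD(1)[OF D that] by simp_all
    qed
    have "bounded_op ip H R"
    proof (rule bounded_opI)
      show "R (x + y) = R x + R y" if "x \<in> H" "y \<in> H" for x y
        using that R bounded_opD(2)[OF D, of "R x" "R y"] by - (rule inj, simp_all)
      show "R (a *\<^sub>C x) = a *\<^sub>C R x" if "x \<in> H" for a x
        using that R bounded_opD(3)[OF D, of "R x" a] by - (rule inj, simp_all)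
      show "ip_norm ip (R x) \<le> inverse c * ip_norm ip x" if "x \<in> H" for x
        using c(2)[of "R x"] R that c(1) by (simp add: field_simps)
    qed (use R in simp)
    then show ?thesis
      using R_D R(2) unfolding op_spectrum_def D_def by blast
  qed
  with eig show ?thesis by (intro set_eqI) (simp, metis)
qed

end

section \<open>Commuting isometries and the core operator\<close>

text \<open>Instantiated three times: with multiplication by z, by w, and by zw.\<close>

locale hilbert_isometry = hilbert ip H for ip :: "'v::complex_vector inner_prod" and H +
  fixes A :: "'v \<Rightarrow> 'v"
  assumes bounded: "bounded_op ip H A"
    and isometry: "\<lbrakk>x \<in> H; y \<in> H\<rbrakk> \<Longrightarrow> ip (A x) (A y) = ip x y"
begin

abbreviation A_adj :: "'v \<Rightarrow> 'v" where "A_adj \<equiv> adjoint_on ip H A"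

lemmas A_simps = bounded_opD[OF bounded]

lemma closed_range: "closed_subspace ip H (A ` H)"
  using isometry by (intro closed_range_if_bounded_below[OF bounded, of 1]) (auto simp: ip_norm_def)

text \<open>The adjoint is built from the projection theorem instead of a representation theorem:
  project \<open>y\<close> onto the closed range of \<open>A\<close> and write the projection as
  \<open>A x\<close>. Since \<open>A\<close> preserves inner products, this \<open>x\<close>
  represents the functional.\<close>

lemma adj_in [simp]: "y \<in> H \<Longrightarrow> A_adj y \<in> H"
  and adj_ip: "\<lbrakk>v \<in> H; y \<in> H\<rbrakk> \<Longrightarrow> ip (A v) y = ip v (A_adj y)"
proof -
  have *: "\<exists>x\<in>H. \<forall>v\<in>H. ip (A v) y = ip v x" if y: "y \<in> H" for y
  proof -
    obtain y' where y': "y' \<in> A ` H" "\<And>w. w \<in> A ` H \<Longrightarrow> ip (y - y') w = 0"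
      using projection_exists[OF closed_range y] by blast
    then obtain x where x: "x \<in> H" "y' = A x" by blast
    have "ip (A v) y = ip v x" if v: "v \<in> H" for v
    proof -
      have "ip (A v) (y - y') = 0"
        using y'(2)[of "A v"] ip_eq_0_commute[of "A v" "y - y'"] v x y A_simps(1) by simp
      then have "ip (A v) y = ip (A v) (A x)" using v x y A_simps(1) by (simp add: ip_linear)
      then show ?thesis using v x isometry by simp
    qed
    with x show ?thesis by blast
  qed
  have adj: "A_adj y \<in> H \<and> (\<forall>v\<in>H. ip (A v) y = ip v (A_adj y))" if y: "y \<in> H" for y
  proof -
    obtain x where x: "x \<in> H" "\<And>v. v \<in> H \<Longrightarrow> ip (A v) y = ip v x" using *[OF y] by blast
    have "A_adj y = x" using x subspace_H by (intro adjoint_on_eqI) auto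
    with x show ?thesis by simp
  qed
  then show "y \<in> H \<Longrightarrow> A_adj y \<in> H" "\<lbrakk>v \<in> H; y \<in> H\<rbrakk> \<Longrightarrow> ip (A v) y = ip v (A_adj y)"
    by blast+
qed

lemma adj_A [simp]: "x \<in> H \<Longrightarrow> A_adj (A x) = x"
  by (rule ip_cancel) (simp_all add: A_simps(1) isometry flip: adj_ip)

text \<open>The squared norm of \<open>A_adj x\<close> equals <A (A_adj x), x>, and \<open>A\<close>
  preserves norms, so Cauchy-Schwarz makes the adjoint a contraction.\<close>

lemma bounded_adj: "bounded_op ip H A_adj"
proof (rule bounded_opI)
  show "A_adj (x + y) = A_adj x + A_adj y" if "x \<in> H" "y \<in> H" for x y
    using that by (intro ip_cancel) (simp_all add: A_simps(1) ip_add_right flip: adj_ip)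
  show "A_adj (c *\<^sub>C x) = c *\<^sub>C A_adj x" if "x \<in> H" for c x
    using that by (intro ip_cancel) (simp_all add: A_simps(1) ip_scale_right flip: adj_ip)
  show "ip_norm ip (A_adj x) \<le> 1 * ip_norm ip x" if x: "x \<in> H" for x
  proof (cases "ip_norm ip (A_adj x) = 0")
    case False
    have "(ip_norm ip (A_adj x))\<^sup>2 = cmod (ip (A_adj x) (A_adj x))"
      using x by (simp add: ip_self norm_power)
    also have "\<dots> = cmod (ip (A (A_adj x)) x)" using x by (simp add: adj_ip)
    also have "\<dots> \<le> ip_norm ip (A (A_adj x)) * ip_norm ip x"
      using x by (intro cauchy_schwarz) (simp_all add: A_simps(1))
    also have "ip_norm ip (A (A_adj x)) = ip_norm ip (A_adj x)"
      using x by (simp add: ip_norm_def isometry)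
    finally show ?thesis using False by (simp add: power2_eq_square less_le)
  qed simp
qed simp

text \<open>Idempotent because \<open>A_adj\<close> is a left inverse of \<open>A\<close>, symmetric
  because \<open>A\<close> can be moved across the inner product twice.\<close>

lemma range_projection: "projection_op ip H (\<lambda>x. A (A_adj x))"
proof -
  have "ip (A (A_adj x)) y = ip x (A (A_adj y))" if "x \<in> H" "y \<in> H" for x y
  proof -
    have "ip (A (A_adj x)) y = cnj (ip (A_adj y) (A_adj x))"
      using that ip_commute[of "A_adj y" "A_adj x"] by (simp add: adj_ip)
    also have "\<dots> = cnj (ip (A (A_adj y)) x)" using that by (simp add: adj_ip)
    also have "\<dots> = ip x (A (A_adj y))"
      using that ip_commute[of "A (A_adj y)" x] by (simp add: A_simps(1))
    finally show ?thesis .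
  qed
  then show ?thesis
    using bounded_op_compose[OF bounded bounded_adj]
    by (simp add: projection_op_def selfadjoint_op_def)
qed

text \<open>The orthogonal projection onto the complement of the range of \<open>A\<close>. For the
  two shifts it agrees on H_p with \<open>Q_z\<close> and \<open>Q_w\<close>.\<close>

definition defect :: "'v \<Rightarrow> 'v" where "defect x = x - A (A_adj x)"

lemma projection_defect: "projection_op ip H defect"
  unfolding defect_def[abs_def] by (rule projection_complement[OF range_projection])

lemma in_range_iff: "x \<in> A ` H \<longleftrightarrow> x \<in> H \<and> defect x = 0"
proof
  assume "x \<in> H \<and> defect x = 0"
  then show "x \<in> A ` H" by (intro image_eqI[of _ _ "A_adj x"]) (auto simp: defect_def)
qed (auto simp: defect_def A_simps(1))

lemma in_ortho_range_iff: "x \<in> ortho_minus ip H (A ` H) \<longleftrightarrow> x \<in> H \<and> defect x = x"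
proof (cases "x \<in> H")
  case x: True
  have "(\<forall>v\<in>H. ip x (A v) = 0) \<longleftrightarrow> (\<forall>v\<in>H. ip v (A_adj x) = 0)"
    using x by (simp add: ip_eq_0_commute[of x] A_simps(1) adj_ip)
  also have "\<dots> \<longleftrightarrow> A_adj x = 0" using x ip_eq_0D[of "A_adj x"] by auto
  \<comment> \<open>Applying the left inverse \<open>A_adj\<close> to \<open>A (A_adj x)\<close>
    recovers \<open>A_adj x\<close>.\<close>
  also have "\<dots> \<longleftrightarrow> A (A_adj x) = 0" using adj_A[OF adj_in[OF x]] A_simps(4) bounded_opD(4)[OF bounded_adj] by metis
  finally show ?thesis using x by (simp add: ortho_minus_def defect_def)
qed (simp add: ortho_minus_def)

lemma closed_subspace_ortho_range: "closed_subspace ip H (ortho_minus ip H (A ` H))"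
  using A_simps(1) by (intro closed_subspace_ortho_minus) auto

lemma ortho_proj_eq_defect:
  assumes x: "x \<in> H"
  shows "ortho_proj ip (ortho_minus ip H (A ` H)) x = defect x"
proof (rule ortho_proj_eqI)
  note P = projection_opD[OF projection_defect]
  show "defect x \<in> ortho_minus ip H (A ` H)" using x P by (simp add: in_ortho_range_iff)
  show "ip (x - defect x) w = 0" if "w \<in> ortho_minus ip H (A ` H)" for w
    using that x P(2)[of x w] P(4) by (simp add: in_ortho_range_iff ip_linear)
qed (use closed_subspace_ortho_range x in \<open>auto simp: closed_subspace_def\<close>)

end

locale commuting_isometries = A: hilbert_isometry ip H A + B: hilbert_isometry ip H B
  for ip :: "'v::complex_vector inner_prod" and H A B +
  assumes commute: "x \<in> H \<Longrightarrow> A (B x) = B (A x)"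
begin

text \<open>The projection onto the range of the product \<open>A B\<close>. The adjoints stand in
  the order used by the core operator; the adjoint of the product has them reversed, and
  \<open>adj_commute\<close> reconciles the two.\<close>

definition joint_projection :: "'v \<Rightarrow> 'v" where
  "joint_projection x = A (B (A.A_adj (B.A_adj x)))"

lemma adj_commute: "x \<in> H \<Longrightarrow> A.A_adj (B.A_adj x) = B.A_adj (A.A_adj x)"
  by (rule A.ip_cancel) (simp_all add: commute A.A_simps(1) B.A_simps(1) flip: A.adj_ip B.adj_ip)

lemma product_isometry: "hilbert_isometry ip H (\<lambda>x. A (B x))"
  by unfold_locales
    (simp_all add: A.bounded_op_compose A.bounded B.bounded A.isometry B.isometry B.A_simps(1))

lemma product_adj: "x \<in> H \<Longrightarrow> adjoint_on ip H (\<lambda>x. A (B x)) x = A.A_adj (B.A_adj x)"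
  by (intro A.adjoint_on_eqI)
    (simp_all add: A.subspace_H adj_commute B.A_simps(1) A.adj_ip B.adj_ip)

lemma projection_joint: "projection_op ip H joint_projection"
proof -
  interpret P: hilbert_isometry ip H "\<lambda>x. A (B x)" by (rule product_isometry)
  \<comment> \<open>This equality holds only on \<open>H\<close>, so boundedness is derived from the
    composition directly and only the two pointwise laws are transferred from the product
    isometry.\<close>
  have eq: "A (B (P.A_adj x)) = joint_projection x" if "x \<in> H" for x
    using that by (simp add: product_adj joint_projection_def)
  have "bounded_op ip H joint_projection"
    unfolding joint_projection_def[abs_def]
    by (rule A.bounded_op_compose[OF A.bounded A.bounded_op_compose[OF B.bounded
          A.bounded_op_compose[OF A.bounded_adj B.bounded_adj]]])
  moreover have "joint_projection x \<in> H" if "x \<in> H" for x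
    using that by (simp add: joint_projection_def A.A_simps(1) B.A_simps(1))
  ultimately show ?thesis
    using A.projection_opD(2,3)[OF P.range_projection]
    by (simp add: projection_op_def selfadjoint_op_def eq)
qed

text \<open>By commutation the range of \<open>A B\<close> lies in the range of \<open>A\<close> and
  in that of \<open>B\<close>, which are the kernels of the two defects. In the other order, each
  adjoint annihilates the corresponding defect.\<close>

lemma defect_joint:
  assumes "x \<in> H"
  shows "A.defect (joint_projection x) = 0" "B.defect (joint_projection x) = 0"
    "joint_projection (A.defect x) = 0" "joint_projection (B.defect x) = 0"
proof -
  note simps = A.A_simps(1) B.A_simps(1) A.A_simps(4) B.A_simps(4)
    A.bounded_opD(4,5)[OF A.bounded_adj] A.bounded_opD(4,5)[OF B.bounded_adj]
  show "A.defect (joint_projection x) = 0"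
    using assms by (simp add: A.defect_def joint_projection_def simps)
  show "B.defect (joint_projection x) = 0"
    using assms by (simp add: B.defect_def joint_projection_def commute simps)
  show "joint_projection (A.defect x) = 0"
    using assms by (simp add: A.defect_def joint_projection_def adj_commute simps)
  show "joint_projection (B.defect x) = 0"
    using assms by (simp add: B.defect_def joint_projection_def simps)
qed

end

section \<open>The core operator as a combination of three projections\<close>

text \<open>The eigenvalue analysis of \<open>C\<close> takes place inside these relations;
  isometries and function spaces return only with the instance \<open>core\<close>. \<open>E\<close>
  and \<open>F\<close> are not assumed to commute: their relative position is the information
  carried by Gamma.\<close>

locale core_projections = pre_hilbert ip H for ip :: "'v::complex_vector inner_prod" and H +
  fixes E F S C :: "'v \<Rightarrow> 'v"
  assumes proj_E: "projection_op ip H E" and proj_F: "projection_op ip H F"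
    and proj_S: "projection_op ip H S"
    and E_S: "x \<in> H \<Longrightarrow> E (S x) = 0" and S_E: "x \<in> H \<Longrightarrow> S (E x) = 0"
    and F_S: "x \<in> H \<Longrightarrow> F (S x) = 0" and S_F: "x \<in> H \<Longrightarrow> S (F x) = 0"
    and C_eq: "x \<in> H \<Longrightarrow> C x = E x + F x - x + S x"
begin

lemmas E_simps = bounded_opD[OF projection_opD(1)[OF proj_E]] projection_opD(3)[OF proj_E]
lemmas F_simps = bounded_opD[OF projection_opD(1)[OF proj_F]] projection_opD(3)[OF proj_F]
lemmas S_simps = bounded_opD[OF projection_opD(1)[OF proj_S]] projection_opD(3)[OF proj_S]

definition fixed_E :: "'v set" where "fixed_E = {x \<in> H. E x = x}"

lemma C_in [simp]: "x \<in> H \<Longrightarrow> C x \<in> H"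
  by (simp add: C_eq E_simps(1) F_simps(1) S_simps(1))

text \<open>\<open>E\<close> annihilates both \<open>E x - x\<close> and \<open>S x\<close>, so only
  the \<open>F\<close> term of \<open>C x\<close> survives; \<open>F\<close> behaves in the same
  way.\<close>

lemma E_C: "x \<in> H \<Longrightarrow> E (C x) = E (F x)"
  and F_C: "x \<in> H \<Longrightarrow> F (C x) = F (E x)"
  by (simp_all add: C_eq E_simps F_simps E_S F_S S_simps(1))

text \<open>For a vector fixed by \<open>E\<close> the term \<open>E x\<close> cancels against
  \<open>- x\<close>, and \<open>S\<close> vanishes on it; likewise for \<open>F\<close>.\<close>

lemma C_E: "x \<in> H \<Longrightarrow> C (E x) = F (E x)"
  and C_F: "x \<in> H \<Longrightarrow> C (F x) = E (F x)"
  by (simp_all add: C_eq E_simps(1,7) F_simps(1,7) S_E S_F)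

lemma C_C_fixed_E: "x \<in> fixed_E \<Longrightarrow> C (C x) = E (F x)"
  using C_E[of x] C_F[of x] by (simp add: fixed_E_def)

lemma ip_C: "\<lbrakk>x \<in> H; y \<in> H\<rbrakk> \<Longrightarrow> ip (C x) y = ip x (C y)"
  using projection_opD(2)[OF proj_E] projection_opD(2)[OF proj_F] projection_opD(2)[OF proj_S]
  by (simp add: C_eq ip_linear E_simps(1) F_simps(1) S_simps(1))

lemma selfadjoint_C: "bounded_op ip H C \<Longrightarrow> selfadjoint_op ip H C"
  using ip_C by (simp add: selfadjoint_op_def)

lemma reduces_C_C:
  assumes "closed_subspace ip H fixed_E"
  shows "reduces ip H (C \<circ> C) fixed_E"
  unfolding reduces_def
proof (intro conjI assms)
  have inv: "C (C x) \<in> fixed_E" if "x \<in> fixed_E" for x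
    using that C_C_fixed_E[OF that] by (simp add: fixed_E_def E_simps(1,7) F_simps(1))
  then show "(C \<circ> C) ` fixed_E \<subseteq> fixed_E" by auto
  \<comment> \<open>Symmetry of \<open>C\<close> moves both factors to \<open>y\<close>, where
    invariance of \<open>fixed_E\<close> applies.\<close>
  have "ip (C (C x)) y = 0" if "x \<in> ortho_minus ip H fixed_E" "y \<in> fixed_E" for x y
    using that inv[of y] by (auto simp: ortho_minus_def ip_C fixed_E_def)
  then show "(C \<circ> C) ` ortho_minus ip H fixed_E \<subseteq> ortho_minus ip H fixed_E"
    by (auto simp: ortho_minus_def)
qed

lemma E_eigenspace_bij:
  assumes \<mu>: "\<mu> \<noteq> 0" "\<mu> \<noteq> -1"
  shows "bij_betw E (eigenspace H C \<mu>) {x \<in> fixed_E. E (F x) = \<mu>\<^sup>2 *\<^sub>C x}"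
proof (rule bij_betwI')
  have inj0: "x = 0" if x: "x \<in> H" "C x = \<mu> *\<^sub>C x" "E x = 0" for x
  proof (rule ccontr)
    assume "x \<noteq> 0"
    \<comment> \<open>With E x = 0 the eigenvalue equation says that the projection F + S has
      eigenvalue 1 + \<mu>, which must be 0 or 1.\<close>
    have eq: "F x + S x = (1 + \<mu>) *\<^sub>C x"
      using C_eq[OF x(1)] x by (simp add: algebra_simps scaleC_add_left scaleC_one)
    then have "1 + \<mu> = 0 \<or> 1 + \<mu> = 1"
      using projection_eigenvalue[OF projection_add[OF proj_F proj_S F_S S_F] x(1) \<open>x \<noteq> 0\<close> eq] by simp
    then show False using \<mu> by (auto simp: add_eq_0_iff)
  qed
  fix x assume "x \<in> eigenspace H C \<mu>"
  then have x: "x \<in> H" "C x = \<mu> *\<^sub>C x" by (auto simp: eigenspace_def)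
  \<comment> \<open>Each of \<open>E C = E F\<close> and \<open>F C = F E\<close> contributes one
    factor \<mu>; together they give E F E x = \<mu>^2 E x.\<close>
  have "E (F x) = \<mu> *\<^sub>C E x" using E_C[of x] x by (simp add: E_simps)
  moreover have "F (E x) = \<mu> *\<^sub>C F x" using F_C[of x] x by (simp add: F_simps)
  ultimately show "E x \<in> {x \<in> fixed_E. E (F x) = \<mu>\<^sup>2 *\<^sub>C x}"
    using x by (simp add: fixed_E_def E_simps F_simps(1) scaleC_scaleC power2_eq_square)
  fix y assume "y \<in> eigenspace H C \<mu>"
  then have y: "y \<in> H" "C y = \<mu> *\<^sub>C y" by (auto simp: eigenspace_def)
  have diff: "C (x - y) = \<mu> *\<^sub>C (x - y)"
    using x y C_eq[of x] C_eq[of y] C_eq[of "x - y"]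
    by (simp add: E_simps F_simps S_simps complex_vector.scale_right_diff_distrib algebra_simps)
  show "E x = E y \<longleftrightarrow> x = y"
    using inj0[of "x - y"] diff x y by (auto simp: E_simps)
next
  fix y assume "y \<in> {x \<in> fixed_E. E (F x) = \<mu>\<^sup>2 *\<^sub>C x}"
  then have y: "y \<in> H" "E y = y" "E (F y) = \<mu>\<^sup>2 *\<^sub>C y" by (auto simp: fixed_E_def)
  \<comment> \<open>Since E (\<mu> y + F y) = (\<mu> + \<mu>^2) y, this normalizes the preimage. The
    factor \<mu> + \<mu>^2 = \<mu> (\<mu> + 1) is invertible exactly under the two assumptions on
    \<mu>.\<close>
  define c where "c = inverse (\<mu> + \<mu>\<^sup>2)"
  have c: "c * (\<mu> + \<mu>\<^sup>2) = 1"
  proof -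
    have "\<mu> + \<mu>\<^sup>2 = \<mu> * (\<mu> + 1)" by (simp add: power2_eq_square algebra_simps)
    then have "\<mu> + \<mu>\<^sup>2 \<noteq> 0" using \<mu> by (simp add: add_eq_0_iff2)
    then show ?thesis by (simp add: c_def)
  qed
  \<comment> \<open>As C y = F y and C (F y) = \<mu>^2 y, applying C to \<mu> y + F y gives \<mu> F
    y + \<mu>^2 y, which is \<mu> times the same vector.\<close>
  define x where "x = c *\<^sub>C (\<mu> *\<^sub>C y + F y)"
  have x: "x \<in> H" using y by (simp add: x_def F_simps(1))
  have C_y: "C y = F y" using C_E[of y] y by simp
  have C_F_y: "C (F y) = \<mu>\<^sup>2 *\<^sub>C y" using C_F[of y] y by simp
  have C_lin: "C (a *\<^sub>C (b *\<^sub>C u + v)) = a *\<^sub>C (b *\<^sub>C C u + C v)" if "u \<in> H" "v \<in> H" for a b u v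
    using that
    by (simp add: C_eq E_simps(1-5) F_simps(1-5) S_simps(1-5) scaleC_add_right scaleC_scaleC
        complex_vector.scale_right_diff_distrib algebra_simps)
  have "C x = \<mu> *\<^sub>C x"
    using y unfolding x_def
    by (simp add: C_lin F_simps(1) C_y C_F_y)
      (simp add: scaleC_scaleC scaleC_add_right power2_eq_square mult_ac add.commute)
  moreover have "E x = y"
  proof -
    have "E x = c *\<^sub>C (\<mu> *\<^sub>C y + \<mu>\<^sup>2 *\<^sub>C y)" using y by (simp add: x_def E_simps(1-3) F_simps(1))
    then show ?thesis using c by (simp add: scaleC_scaleC scaleC_one flip: scaleC_add_left)
  qed
  ultimately show "\<exists>x\<in>eigenspace H C \<mu>. y = E x" using x by (intro bexI[of _ x]) (simp_all add: eigenspace_def)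
qed

lemma bounded_C: "bounded_op ip H C"
proof -
  have "bounded_op ip H (\<lambda>x. E x + F x - x + S x)"
    using projection_opD(1) proj_E proj_F proj_S
    by (intro bounded_op_add bounded_op_diff bounded_op_id) auto
  then show ?thesis
    by (simp add: bounded_op_def C_eq E_simps(1) F_simps(1) S_simps(1) image_subset_iff)
qed

lemma has_dim_eigenspace_C:
  assumes "\<mu> \<noteq> 0" "\<mu> \<noteq> -1"
  shows "has_dim (eigenspace H C \<mu>) m \<longleftrightarrow> has_dim {x \<in> fixed_E. E (F x) = \<mu>\<^sup>2 *\<^sub>C x} m"
  using E_simps(2,3)
  by (intro has_dim_linear_bij[OF subspace_eigenspace[OF bounded_C] E_eigenspace_bij[OF assms]])
    (auto simp: eigenspace_def)

text \<open>Spectrum and \<open>singular_value\<close> ask for a non-zero space of any dimension,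
  which \<open>has_dim\<close> cannot express, so this comes from the bijection and not from a
  count.\<close>

lemma eigenspace_C_nontrivial_iff:
  assumes "\<mu> \<noteq> 0" "\<mu> \<noteq> -1"
  shows "eigenspace H C \<mu> \<noteq> {0} \<longleftrightarrow> {x \<in> fixed_E. E (F x) = \<mu>\<^sup>2 *\<^sub>C x} \<noteq> {0}"
proof -
  have "0 \<in> eigenspace H C \<mu>" using bounded_opD(4)[OF bounded_C] by (simp add: eigenspace_def)
  then show ?thesis
    using E_eigenspace_bij[OF assms] E_simps(4)
      inj_on_image_eq_iff[of E "eigenspace H C \<mu>" "eigenspace H C \<mu>" "{0}"]
    by (auto simp: bij_betw_def)
qed

text \<open>With T = 1 - F - S one has \<mu> |x|^2 = |E x|^2 - |T x|^2, and both terms on the right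
  lie between 0 and |x|^2.\<close>

lemma C_eigenvalue_bounds:
  assumes "eigenspace H C \<mu> \<noteq> {0}"
  obtains s where "\<mu> = complex_of_real s" "-1 \<le> s" "s \<le> 1"
proof -
  have "0 \<in> eigenspace H C \<mu>" using bounded_opD(4)[OF bounded_C] by (simp add: eigenspace_def)
  then have "\<not> eigenspace H C \<mu> \<subseteq> {0}" using assms by (auto intro: subset_antisym)
  then obtain x where "x \<in> eigenspace H C \<mu>" "x \<noteq> 0" by (auto simp: subset_iff)
  then have x: "x \<in> H" "C x = \<mu> *\<^sub>C x" "x \<noteq> 0" by (auto simp: eigenspace_def)
  have "\<mu> \<in> \<real>"
    using selfadjoint_eigenvalue_real[OF selfadjoint_C[OF bounded_C] x(1,3,2)] .
  then obtain s where s: "\<mu> = complex_of_real s" by (auto elim: Reals_cases)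
  let ?T = "\<lambda>x. x - (F x + S x)"
  have T: "projection_op ip H ?T"
    by (intro projection_complement projection_add proj_F proj_S F_S S_F)
  have "C x = E x - ?T x" using C_eq[OF x(1)] by (simp add: algebra_simps)
  then have "\<mu> * ip x x = ip (E x) x - ip (?T x) x"
    using x E_simps(1)[of x] projection_opD(4)[OF T x(1)] by (metis ip_diff_left ip_scale_left)
  then have "complex_of_real (s * (ip_norm ip x)\<^sup>2)
      = complex_of_real ((ip_norm ip (E x))\<^sup>2 - (ip_norm ip (?T x))\<^sup>2)"
    using projection_ip_self[OF proj_E x(1)] projection_ip_self[OF T x(1)] ip_self[OF x(1)] s by simp
  then have eq: "s * (ip_norm ip x)\<^sup>2 = (ip_norm ip (E x))\<^sup>2 - (ip_norm ip (?T x))\<^sup>2"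
    by (simp only: of_real_eq_iff)
  have le: "(ip_norm ip (E x))\<^sup>2 \<le> (ip_norm ip x)\<^sup>2" "(ip_norm ip (?T x))\<^sup>2 \<le> (ip_norm ip x)\<^sup>2"
    using projection_norm_le[OF proj_E x(1)] projection_norm_le[OF T x(1)] by (auto intro: power_mono)
  have pos: "(ip_norm ip x)\<^sup>2 > 0" using x by simp
  have "s * (ip_norm ip x)\<^sup>2 \<le> 1 * (ip_norm ip x)\<^sup>2" "(-1) * (ip_norm ip x)\<^sup>2 \<le> s * (ip_norm ip x)\<^sup>2"
    using eq le zero_le_power2[of "ip_norm ip (E x)"] zero_le_power2[of "ip_norm ip (?T x)"] by linarith+
  then have "s \<le> 1" "-1 \<le> s" using pos by (auto simp only: mult_le_cancel_right_pos)
  with s show ?thesis using that by blast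
qed

text \<open>1 - C is the sum of the projections 1 - E and 1 - F - S, so its quadratic form is a sum
  of two squares and both projections annihilate an eigenvector.\<close>

lemma eigenspace_C_1: "eigenspace H C 1 = {x \<in> H. E x = x \<and> F x = x}"
proof (intro equalityI subsetI)
  fix x assume "x \<in> eigenspace H C 1"
  then have x: "x \<in> H" "C x = x" by (auto simp: eigenspace_def scaleC_one)
  let ?E = "\<lambda>x. x - E x" and ?T = "\<lambda>x. x - (F x + S x)"
  have PE: "projection_op ip H ?E" and PT: "projection_op ip H ?T"
    by (intro projection_complement projection_add proj_E proj_F proj_S F_S S_F)+
  have "?E x + ?T x = 0" using C_eq[OF x(1)] x(2) by (simp add: algebra_simps)
  then have "ip (?E x) x + ip (?T x) x = 0"
    using ip_add_left[of "?E x" "?T x" x] projection_opD(4)[OF PE x(1)] projection_opD(4)[OF PT x(1)] x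
    by simp
  then have "complex_of_real ((ip_norm ip (?E x))\<^sup>2 + (ip_norm ip (?T x))\<^sup>2) = 0"
    using projection_ip_self[OF PE x(1)] projection_ip_self[OF PT x(1)] by simp
  then have "(ip_norm ip (?E x))\<^sup>2 + (ip_norm ip (?T x))\<^sup>2 = 0" by (simp only: of_real_eq_0_iff)
  then have "?E x = 0" "?T x = 0"
    using projection_opD(4)[OF PE x(1)] projection_opD(4)[OF PT x(1)] by (auto simp: sum_power2_eq_zero_iff)
  \<comment> \<open>From E x = x follows S x = S (E x) = 0, and then the second equation reduces to
    F x = x.\<close>
  then show "x \<in> {x \<in> H. E x = x \<and> F x = x}" using x S_E[of x] by simp
next
  fix x assume "x \<in> {x \<in> H. E x = x \<and> F x = x}"
  then show "x \<in> eigenspace H C 1" using C_E[of x] by (simp add: eigenspace_def scaleC_one)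
qed

text \<open>C + 1 = E + F + S has a sum of three squares as quadratic form. The conditions on
  \<open>E\<close> and \<open>F\<close> describe the intersection of the two ranges, the condition
  on \<open>S\<close> orthogonality to zw H_p.\<close>

lemma eigenspace_C_minus_1: "eigenspace H C (-1) = {x \<in> H. E x = 0 \<and> F x = 0 \<and> S x = 0}"
proof (intro equalityI subsetI)
  fix x assume "x \<in> eigenspace H C (-1)"
  then have x: "x \<in> H" "C x = - x" by (auto simp: eigenspace_def)
  have in_H: "E x \<in> H" "F x \<in> H" "S x \<in> H" using x by (simp_all add: E_simps(1) F_simps(1) S_simps(1))
  have "E x + F x + S x = 0" using C_eq[OF x(1)] x(2) by (simp add: algebra_simps)
  then have "ip (E x) x + ip (F x) x + ip (S x) x = 0"
    using ip_add_left[of "E x + F x" "S x" x] ip_add_left[of "E x" "F x" x] in_H x by simp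
  then have "complex_of_real ((ip_norm ip (E x))\<^sup>2 + (ip_norm ip (F x))\<^sup>2 + (ip_norm ip (S x))\<^sup>2) = 0"
    using projection_ip_self[OF _ x(1)] proj_E proj_F proj_S by simp
  then have "(ip_norm ip (E x))\<^sup>2 + (ip_norm ip (F x))\<^sup>2 + (ip_norm ip (S x))\<^sup>2 = 0"
    by (simp only: of_real_eq_0_iff)
  then have "ip_norm ip (E x) = 0 \<and> ip_norm ip (F x) = 0 \<and> ip_norm ip (S x) = 0"
    by (metis add_nonneg_eq_0_iff sum_power2_ge_zero sum_power2_eq_zero_iff zero_le_power2 power2_eq_iff_nonneg zero_power2 order_refl ip_norm_ge_0)
  then show "x \<in> {x \<in> H. E x = 0 \<and> F x = 0 \<and> S x = 0}" using x in_H by simp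
next
  fix x assume "x \<in> {x \<in> H. E x = 0 \<and> F x = 0 \<and> S x = 0}"
  then show "x \<in> eigenspace H C (-1)" by (simp add: eigenspace_def C_eq)
qed

end

section \<open>Completeness of square integrable functions\<close>

lemma cmod_add_sq_le: "(cmod (a + b))\<^sup>2 \<le> 2 * (cmod a)\<^sup>2 + 2 * (cmod b)\<^sup>2"
proof -
  have "(cmod (a + b))\<^sup>2 \<le> (cmod a + cmod b)\<^sup>2" by (intro power_mono norm_triangle_ineq) simp
  also have "\<dots> \<le> 2 * (cmod a)\<^sup>2 + 2 * (cmod b)\<^sup>2"
    using zero_le_power2[of "cmod a - cmod b"] by (simp add: power2_sum power2_diff)
  finally show ?thesis .
qed

lemma integrable_cmod_add_sq:
  assumes [measurable]: "f \<in> borel_measurable M" "g \<in> borel_measurable M"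
    and "integrable M (\<lambda>x. (cmod (f x))\<^sup>2)" "integrable M (\<lambda>x. (cmod (g x))\<^sup>2)"
  shows "integrable M (\<lambda>x. (cmod (f x + g x))\<^sup>2)"
proof (rule Bochner_Integration.integrable_bound)
  show "integrable M (\<lambda>x. 2 * (cmod (f x))\<^sup>2 + 2 * (cmod (g x))\<^sup>2)" using assms by simp
  show "AE x in M. norm ((cmod (f x + g x))\<^sup>2) \<le> norm (2 * (cmod (f x))\<^sup>2 + 2 * (cmod (g x))\<^sup>2)"
    using cmod_add_sq_le by (intro AE_I2) (simp add: abs_of_nonneg)
qed simp

lemma integrable_mult_cnj:
  assumes [measurable]: "f \<in> borel_measurable M" "g \<in> borel_measurable M"
    and "integrable M (\<lambda>x. (cmod (f x))\<^sup>2)" "integrable M (\<lambda>x. (cmod (g x))\<^sup>2)"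
  shows "integrable M (\<lambda>x. f x * cnj (g x))"
proof (rule Bochner_Integration.integrable_bound)
  show "integrable M (\<lambda>x. (cmod (f x))\<^sup>2 + (cmod (g x))\<^sup>2)" using assms by simp
  have [measurable]: "cnj \<in> borel_measurable borel"
    by (intro borel_measurable_continuous_onI continuous_intros)
  show "(\<lambda>x. f x * cnj (g x)) \<in> borel_measurable M" by measurable
  have "cmod a * cmod b \<le> (cmod a)\<^sup>2 + (cmod b)\<^sup>2" for a b
  proof -
    have "2 * (cmod a * cmod b) \<le> (cmod a)\<^sup>2 + (cmod b)\<^sup>2"
      using zero_le_power2[of "cmod a - cmod b"] by (simp add: power2_diff)
    moreover have "0 \<le> cmod a * cmod b" by simp
    ultimately show ?thesis by linarith
  qed
  then show "AE x in M. norm (f x * cnj (g x)) \<le> norm ((cmod (f x))\<^sup>2 + (cmod (g x))\<^sup>2)"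
    by (intro AE_I2) (simp add: norm_mult)
qed

text \<open>The L^1 norm is bounded by the L^2 norm through the pointwise inequality a \<le> a^2 /
  (2 \<delta>) + \<delta> / 2; over a probability measure each half integrates to at most \<delta> /
  2.\<close>

lemma (in prob_space) integral_cmod_le:
  assumes [measurable]: "f \<in> borel_measurable M" and int: "integrable M (\<lambda>x. (cmod (f x))\<^sup>2)"
    and le: "(\<integral>x. (cmod (f x))\<^sup>2 \<partial>M) \<le> \<delta>\<^sup>2" and \<delta>: "\<delta> > 0"
  shows "integrable M (\<lambda>x. cmod (f x))" "(\<integral>x. cmod (f x) \<partial>M) \<le> \<delta>"
proof -
  have ptw: "cmod a \<le> (cmod a)\<^sup>2 / (2 * \<delta>) + \<delta> / 2" for a
  proof -
    have "0 \<le> (cmod a - \<delta>)\<^sup>2 / (2 * \<delta>)" using \<delta> by simp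
    also have "\<dots> = (cmod a)\<^sup>2 / (2 * \<delta>) + \<delta> / 2 - cmod a"
      using \<delta> by (simp add: field_simps power2_eq_square)
    finally show ?thesis by simp
  qed
  have int': "integrable M (\<lambda>x. (cmod (f x))\<^sup>2 / (2 * \<delta>) + \<delta> / 2)" using int by simp
  show int1: "integrable M (\<lambda>x. cmod (f x))"
    by (rule Bochner_Integration.integrable_bound[OF int'])
      (use ptw \<delta> in \<open>auto intro!: AE_I2 simp: abs_of_nonneg\<close>)
  have "(\<integral>x. cmod (f x) \<partial>M) \<le> (\<integral>x. (cmod (f x))\<^sup>2 / (2 * \<delta>) + \<delta> / 2 \<partial>M)"
    using int1 int' ptw by (intro integral_mono) auto
  also have "\<dots> = (\<integral>x. (cmod (f x))\<^sup>2 \<partial>M) / (2 * \<delta>) + \<delta> / 2"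
    using int by (simp add: prob_space)
  also have "\<dots> \<le> \<delta>\<^sup>2 / (2 * \<delta>) + \<delta> / 2" using le \<delta> by (intro add_mono divide_right_mono) auto
  also have "\<dots> = \<delta>" using \<delta> by (simp add: power2_eq_square)
  finally show "(\<integral>x. cmod (f x) \<partial>M) \<le> \<delta>" .
qed

text \<open>The increments have summable L^1 norms, so their absolute series has finite integral and
  converges almost everywhere; the increments telescope.\<close>

lemma (in prob_space) L2_fast_Cauchy_AE_convergent:
  fixes g :: "nat \<Rightarrow> 'a \<Rightarrow> complex"
  assumes [measurable]: "\<And>k. g k \<in> borel_measurable M"
    and int: "\<And>k. integrable M (\<lambda>x. (cmod (g (Suc k) x - g k x))\<^sup>2)"
    and le: "\<And>k. (\<integral>x. (cmod (g (Suc k) x - g k x))\<^sup>2 \<partial>M) \<le> ((1/2) ^ k)\<^sup>2"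
  shows "AE x in M. convergent (\<lambda>k. g k x)"
proof -
  let ?d = "\<lambda>k x. cmod (g (Suc k) x - g k x)"
  have int1: "integrable M (?d k)" "(\<integral>x. ?d k x \<partial>M) \<le> (1/2) ^ k" for k
    using integral_cmod_le[OF _ int le, of k] by simp_all
  have "(\<integral>\<^sup>+x. (\<Sum>k. ennreal (?d k x)) \<partial>M) = (\<Sum>k. \<integral>\<^sup>+x. ennreal (?d k x) \<partial>M)"
    by (intro nn_integral_suminf) measurable
  also have "\<dots> \<le> (\<Sum>k. ennreal ((1/2) ^ k))"
    using int1 by (intro suminf_le summableI) (simp add: nn_integral_eq_integral ennreal_leI)
  also have "\<dots> = ennreal (\<Sum>k. (1/2) ^ k)"
    by (intro suminf_ennreal2) (auto intro: summable_geometric)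
  also have "\<dots> < \<infinity>" by simp
  finally have "(\<integral>\<^sup>+x. (\<Sum>k. ennreal (?d k x)) \<partial>M) \<noteq> \<infinity>" by simp
  then have "AE x in M. (\<Sum>k. ennreal (?d k x)) \<noteq> \<infinity>"
    by (intro nn_integral_PInf_AE) measurable
  then show ?thesis
  proof eventually_elim
    case (elim x)
    then have "summable (\<lambda>k. ?d k x)" by (intro summable_suminf_not_top) auto
    then have "summable (\<lambda>k. g (Suc k) x - g k x)" by (rule summable_norm_cancel)
    then have "convergent (\<lambda>n. \<Sum>k<n. g (Suc k) x - g k x)" by (simp add: summable_iff_convergent)
    then have "convergent (\<lambda>n. (g n x - g 0 x) + g 0 x)"
      by (intro convergent_add convergent_const) (simp add: sum_lessThan_telescope[of "\<lambda>k. g k x"])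
    then show "convergent (\<lambda>n. g n x)" by simp
  qed
qed

text \<open>Riesz-Fischer: a fast subsequence has an almost everywhere limit, and Fatou's lemma
  shows that the whole sequence converges to it in L^2.\<close>

lemma (in prob_space) L2_complete:
  fixes F :: "nat \<Rightarrow> 'a \<Rightarrow> complex"
  assumes [measurable]: "\<And>n. F n \<in> borel_measurable M"
    and int: "\<And>n. integrable M (\<lambda>x. (cmod (F n x))\<^sup>2)"
    and cauchy: "\<And>\<epsilon>. \<epsilon> > 0 \<Longrightarrow> \<exists>N. \<forall>m\<ge>N. \<forall>n\<ge>N. (\<integral>x. (cmod (F m x - F n x))\<^sup>2 \<partial>M) < \<epsilon>"
  obtains f where "f \<in> borel_measurable M" "integrable M (\<lambda>x. (cmod (f x))\<^sup>2)"
    "(\<lambda>n. \<integral>x. (cmod (F n x - f x))\<^sup>2 \<partial>M) \<longlonglongrightarrow> 0"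
proof -
  have int_diff: "integrable M (\<lambda>x. (cmod (F m x - F n x))\<^sup>2)" for m n
    using integrable_cmod_add_sq[of "F m" M "\<lambda>x. - F n x"] int by simp
  have "\<exists>N. \<forall>k. (\<forall>m\<ge>N k. \<forall>n\<ge>N k. (\<integral>x. (cmod (F m x - F n x))\<^sup>2 \<partial>M) < ((1/2) ^ k)\<^sup>2)"
    by (intro choice allI cauchy) simp
  then obtain N where N: "\<And>k m n. m \<ge> N k \<Longrightarrow> n \<ge> N k \<Longrightarrow>
      (\<integral>x. (cmod (F m x - F n x))\<^sup>2 \<partial>M) < ((1/2) ^ k)\<^sup>2" by blast
  \<comment> \<open>Adding all thresholds up to \<open>k\<close> makes \<open>r\<close> monotone and
    at least \<open>N k\<close>, so \<open>N k\<close> controls both \<open>r k\<close> and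
    \<open>r (Suc k)\<close>; the extra \<open>k\<close> makes \<open>r\<close> unbounded.\<close>
  define r where "r k = (\<Sum>i\<le>k. N i) + k" for k
  have r: "N k \<le> r k" "r k \<le> r (Suc k)" "k \<le> r k" for k
    by (auto simp: r_def intro: member_le_sum trans_le_add1)
  define g where "g k = F (r k)" for k
  have [measurable]: "g k \<in> borel_measurable M" for k by (simp add: g_def)
  have AE_conv: "AE x in M. convergent (\<lambda>k. g k x)"
  proof (rule L2_fast_Cauchy_AE_convergent)
    show "(\<integral>x. (cmod (g (Suc k) x - g k x))\<^sup>2 \<partial>M) \<le> ((1/2) ^ k)\<^sup>2" for k
      using N[of k "r (Suc k)" "r k"] r(1,2)[of k] by (simp add: g_def)
  qed (use int_diff in \<open>simp_all add: g_def\<close>)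
  \<comment> \<open>\<open>lim\<close> is total, so \<open>f\<close> is defined everywhere and
    measurable; it is a genuine limit only off a null set.\<close>
  define f where "f x = lim (\<lambda>k. g k x)" for x
  have f [measurable]: "f \<in> borel_measurable M" unfolding f_def[abs_def] by measurable
  \<comment> \<open>The Cauchy estimate with \<open>F m\<close> replaced by its limit
    \<open>f\<close>, by Fatou along the subsequence. It is stated for the nonnegative integral
    because integrability of the difference is deduced from it.\<close>
  have bound: "(\<integral>\<^sup>+x. ennreal ((cmod (F n x - f x))\<^sup>2) \<partial>M) \<le> ennreal \<epsilon>"
    if \<epsilon>: "\<epsilon> > 0" and L: "\<And>m n. m \<ge> L \<Longrightarrow> n \<ge> L \<Longrightarrow> (\<integral>x. (cmod (F m x - F n x))\<^sup>2 \<partial>M) < \<epsilon>"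
      and n: "n \<ge> L" for \<epsilon> L n
  proof -
    have "(\<integral>\<^sup>+x. ennreal ((cmod (F n x - f x))\<^sup>2) \<partial>M)
        = (\<integral>\<^sup>+x. liminf (\<lambda>k. ennreal ((cmod (F n x - g k x))\<^sup>2)) \<partial>M)"
    proof (rule nn_integral_cong_AE)
      show "AE x in M. ennreal ((cmod (F n x - f x))\<^sup>2) = liminf (\<lambda>k. ennreal ((cmod (F n x - g k x))\<^sup>2))"
        using AE_conv
      proof eventually_elim
        case (elim x)
        then have "(\<lambda>k. g k x) \<longlonglongrightarrow> f x" by (simp add: f_def convergent_LIMSEQ_iff)
        then have "(\<lambda>k. ennreal ((cmod (F n x - g k x))\<^sup>2)) \<longlonglongrightarrow> ennreal ((cmod (F n x - f x))\<^sup>2)"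
          by (intro tendsto_ennrealI tendsto_intros)
        then show ?case by (intro lim_imp_Liminf[symmetric]) simp_all
      qed
    qed
    also have "\<dots> \<le> liminf (\<lambda>k. \<integral>\<^sup>+x. ennreal ((cmod (F n x - g k x))\<^sup>2) \<partial>M)"
      by (intro nn_integral_liminf) measurable
    also have "\<dots> \<le> liminf (\<lambda>k. ennreal \<epsilon>)"
    proof (rule Liminf_mono)
      show "\<forall>\<^sub>F k in sequentially. (\<integral>\<^sup>+x. ennreal ((cmod (F n x - g k x))\<^sup>2) \<partial>M) \<le> ennreal \<epsilon>"
        using eventually_ge_at_top[of L]
      proof eventually_elim
        case (elim k)
        then have "r k \<ge> L" using r(3)[of k] by simp
        from L[OF n this] show ?case
          using int_diff[of n "r k"] by (simp add: g_def nn_integral_eq_integral ennreal_leI)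
      qed
    qed
    also have "\<dots> = ennreal \<epsilon>" by (simp add: Liminf_const)
    finally show ?thesis .
  qed
  have int_f: "integrable M (\<lambda>x. (cmod (F n x - f x))\<^sup>2) \<and> (\<integral>x. (cmod (F n x - f x))\<^sup>2 \<partial>M) \<le> \<epsilon>"
    if \<epsilon>: "\<epsilon> > 0" and L: "\<And>m n. m \<ge> L \<Longrightarrow> n \<ge> L \<Longrightarrow> (\<integral>x. (cmod (F m x - F n x))\<^sup>2 \<partial>M) < \<epsilon>"
      and n: "n \<ge> L" for \<epsilon> L n
  proof
    show I: "integrable M (\<lambda>x. (cmod (F n x - f x))\<^sup>2)"
      using bound[OF that] by (intro integrableI_bounded) (auto simp: top_unique less_top[symmetric])
    have "ennreal (\<integral>x. (cmod (F n x - f x))\<^sup>2 \<partial>M) \<le> ennreal \<epsilon>"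
      using bound[OF that] I by (simp add: nn_integral_eq_integral)
    then show "(\<integral>x. (cmod (F n x - f x))\<^sup>2 \<partial>M) \<le> \<epsilon>" using \<epsilon> by (simp add: ennreal_le_iff)
  qed
  show ?thesis
  proof
    show "f \<in> borel_measurable M" by simp
    obtain L where L: "\<And>m n. m \<ge> L \<Longrightarrow> n \<ge> L \<Longrightarrow> (\<integral>x. (cmod (F m x - F n x))\<^sup>2 \<partial>M) < 1"
      using cauchy[of 1] by auto
    \<comment> \<open>\<open>f\<close> is written as \<open>F L\<close> minus
      \<open>F L - f\<close>, both square integrable.\<close>
    have "integrable M (\<lambda>x. (cmod (F L x + - (F L x - f x)))\<^sup>2)"
      using int_f[OF _ L order_refl] int[of L]
      by (intro integrable_cmod_add_sq) (simp_all only: norm_minus_cancel zero_less_one, measurable)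
    then show "integrable M (\<lambda>x. (cmod (f x))\<^sup>2)" by simp
    show "(\<lambda>n. \<integral>x. (cmod (F n x - f x))\<^sup>2 \<partial>M) \<longlonglongrightarrow> 0"
    proof (rule LIMSEQ_I)
      fix \<epsilon> :: real assume \<epsilon>: "\<epsilon> > 0"
      then obtain L where L: "\<And>m n. m \<ge> L \<Longrightarrow> n \<ge> L \<Longrightarrow> (\<integral>x. (cmod (F m x - F n x))\<^sup>2 \<partial>M) < \<epsilon> / 2"
        using cauchy[of "\<epsilon> / 2"] by auto
      have "norm ((\<integral>x. (cmod (F n x - f x))\<^sup>2 \<partial>M) - 0) < \<epsilon>" if "n \<ge> L" for n
      proof -
        have "(\<integral>x. (cmod (F n x - f x))\<^sup>2 \<partial>M) \<le> \<epsilon> / 2" using int_f[OF _ L that] \<epsilon> by simp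
        then show ?thesis using \<epsilon> by (simp add: abs_of_nonneg)
      qed
      then show "\<exists>no. \<forall>n\<ge>no. norm ((\<integral>x. (cmod (F n x - f x))\<^sup>2 \<partial>M) - 0) < \<epsilon>" by blast
    qed
  qed
qed

section \<open>The weighted model\<close>

lemma ortho_minus_antimono: "V \<subseteq> W \<Longrightarrow> ortho_minus ip H W \<subseteq> ortho_minus ip H V"
  by (auto simp: ortho_minus_def)

text \<open>In the partial quotient only measurable functions represent an element, so computations
  with representatives carry measurability along.\<close>

lemma torus_fun_cases:
  obtains f where "x = abs_torus_fun f" "f \<in> borel_measurable haar_torus"
  by (induction x rule: torus_fun.abs_induct) auto

lemma abs_torus_fun_eq_iff:
  assumes "f \<in> borel_measurable haar_torus" "g \<in> borel_measurable haar_torus"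
  shows "abs_torus_fun f = abs_torus_fun g \<longleftrightarrow> (AE x in haar_torus. f x = g x)"
  using Quotient_rel[OF Quotient_torus_fun, of f g] assms by auto

lemma borel_measurable_nu_measure [simp]: "borel_measurable (nu_measure p) = borel_measurable haar_torus"
  by (rule measurable_cong_sets) simp_all

lemma space_nu_measure: "space (nu_measure p) = sphere 0 1 \<times> sphere 0 1"
  by (simp add: nu_measure_def space_haar_torus)

lemma abs_torus_fun_simps:
  assumes "f \<in> borel_measurable haar_torus"
  shows "square_integrable p (abs_torus_fun f) \<longleftrightarrow> integrable (nu_measure p) (\<lambda>x. (cmod (f x))\<^sup>2)"
    "c *\<^sub>C abs_torus_fun f = abs_torus_fun (\<lambda>x. c * f x)"
    "- abs_torus_fun f = abs_torus_fun (\<lambda>x. - f x)"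
    "mult_z (abs_torus_fun f) = abs_torus_fun (\<lambda>x. fst x * f x)"
    "mult_w (abs_torus_fun f) = abs_torus_fun (\<lambda>x. snd x * f x)"
    "abs_torus_fun f = 0 \<longleftrightarrow> (AE x in haar_torus. f x = 0)"
  using assms abs_torus_fun_eq_iff[of f "\<lambda>_. 0"]
  by (simp_all add: square_integrable.abs_eq scaleC_torus_fun.abs_eq uminus_torus_fun.abs_eq
      mult_z.abs_eq mult_w.abs_eq zero_torus_fun_def)

lemma abs_torus_fun_simps2:
  assumes "f \<in> borel_measurable haar_torus" "g \<in> borel_measurable haar_torus"
  shows "abs_torus_fun f + abs_torus_fun g = abs_torus_fun (\<lambda>x. f x + g x)"
    "abs_torus_fun f - abs_torus_fun g = abs_torus_fun (\<lambda>x. f x - g x)"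
    "ip_nu p (abs_torus_fun f) (abs_torus_fun g) = (\<integral>x. f x * cnj (g x) \<partial>nu_measure p)"
  using assms by (simp_all add: plus_torus_fun.abs_eq minus_torus_fun.abs_eq ip_nu.abs_eq)

text \<open>Also correct if |f|^2 is not integrable, since both integrals are then 0 by
  convention.\<close>

lemma ip_nu_self:
  assumes "f \<in> borel_measurable haar_torus"
  shows "ip_nu p (abs_torus_fun f) (abs_torus_fun f)
    = complex_of_real (\<integral>x. (cmod (f x))\<^sup>2 \<partial>nu_measure p)"
  using assms by (simp add: abs_torus_fun_simps2 flip: complex_norm_square integral_complex_of_real)

lemma ip_norm_nu:
  assumes "f \<in> borel_measurable haar_torus"
  shows "ip_norm (ip_nu p) (abs_torus_fun f) = sqrt (\<integral>x. (cmod (f x))\<^sup>2 \<partial>nu_measure p)"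
  using assms by (simp add: ip_norm_def ip_nu_self abs_of_nonneg)

lemma mult_z_linear: "mult_z (x + y) = mult_z x + mult_z y" "mult_z (c *\<^sub>C x) = c *\<^sub>C mult_z x"
  and mult_w_linear: "mult_w (x + y) = mult_w x + mult_w y" "mult_w (c *\<^sub>C x) = c *\<^sub>C mult_w x"
  and mult_z_w: "mult_z (mult_w x) = mult_w (mult_z x)"
  by (transfer; auto simp: algebra_simps)+

lemma torus_poly_linear:
  "torus_poly q + torus_poly r = torus_poly (q + r)"
  "c *\<^sub>C torus_poly q = torus_poly (smult [:c:] q)"
  "mult_z (torus_poly q) = torus_poly (smult [:0, 1:] q)"
  "mult_w (torus_poly q) = torus_poly (pCons 0 q)"
  by (simp_all add: torus_poly.abs_eq abs_torus_fun_simps abs_torus_fun_simps2)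
    (simp_all add: bipoly_eval_def[abs_def])

lemma subspace_range_torus_poly: "complex_vector.subspace (range torus_poly)"
proof (rule complex_vector.subspaceI)
  show "0 \<in> range torus_poly"
    by (intro range_eqI[of _ _ 0]) (simp add: torus_poly.abs_eq bipoly_eval_def[abs_def] zero_torus_fun_def)
qed (auto simp: torus_poly_linear)

section \<open>The Hilbert space H_p and its shifts\<close>

locale weighted_model =
  fixes p :: "complex poly poly"
  assumes p_nonzero: "p \<noteq> 0"
begin

sublocale nu: prob_space "nu_measure p"
proof
  let ?c = "\<integral>y. (cmod (bipoly_eval p y))\<^sup>2 \<partial>haar_torus"
  have pos: "?c > 0" by (rule norm_bipoly_pos[OF p_nonzero])
  \<comment> \<open>A non-integrable function has integral 0, so positivity of the integral already
    yields integrability.\<close>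
  then have int: "integrable haar_torus (\<lambda>x. (cmod (bipoly_eval p x))\<^sup>2)"
    using not_integrable_integral_eq by fastforce
  have "emeasure (nu_measure p) (space (nu_measure p))
      = (\<integral>\<^sup>+x. ennreal ((cmod (bipoly_eval p x))\<^sup>2 / ?c) \<partial>haar_torus)"
    unfolding nu_measure_def
    by (subst emeasure_density) (auto intro!: nn_integral_cong)
  also have "\<dots> = ennreal (\<integral>x. (cmod (bipoly_eval p x))\<^sup>2 / ?c \<partial>haar_torus)"
    using int pos by (intro nn_integral_eq_integral) auto
  also have "\<dots> = 1" using pos by simp
  finally show "emeasure (nu_measure p) (space (nu_measure p)) = 1" .
qed

sublocale L2: pre_hilbert "ip_nu p" "L2_nu p"
proof
  show "complex_vector.subspace (L2_nu p)"
  proof (rule complex_vector.subspaceI)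
    show "0 \<in> L2_nu p" by (simp add: L2_nu_def zero_torus_fun_def abs_torus_fun_simps)
  next
    fix x y assume "x \<in> L2_nu p" "y \<in> L2_nu p"
    then show "x + y \<in> L2_nu p"
      by (cases x rule: torus_fun_cases; cases y rule: torus_fun_cases)
        (simp add: L2_nu_def abs_torus_fun_simps abs_torus_fun_simps2 integrable_cmod_add_sq)
  next
    fix c x assume "x \<in> L2_nu p"
    then show "c *\<^sub>C x \<in> L2_nu p"
      by (cases x rule: torus_fun_cases)
        (simp add: L2_nu_def abs_torus_fun_simps norm_mult power_mult_distrib)
  qed
next
  fix x y z assume "x \<in> L2_nu p" "y \<in> L2_nu p" "z \<in> L2_nu p"
  then show "ip_nu p (x + y) z = ip_nu p x z + ip_nu p y z"
    by (cases x rule: torus_fun_cases; cases y rule: torus_fun_cases; cases z rule: torus_fun_cases)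
      (simp add: L2_nu_def abs_torus_fun_simps abs_torus_fun_simps2 distrib_right integrable_mult_cnj)
next
  fix x y c
  show "ip_nu p (c *\<^sub>C x) y = c * ip_nu p x y"
    by (cases x rule: torus_fun_cases; cases y rule: torus_fun_cases)
      (simp add: abs_torus_fun_simps abs_torus_fun_simps2 mult.assoc)
  show "ip_nu p y x = cnj (ip_nu p x y)"
    by (cases x rule: torus_fun_cases; cases y rule: torus_fun_cases)
      (simp add: abs_torus_fun_simps2 mult.commute flip: Bochner_Integration.integral_cnj)
  show "ip_nu p (- x) (- y) = ip_nu p x y"
    by (cases x rule: torus_fun_cases; cases y rule: torus_fun_cases)
      (simp add: abs_torus_fun_simps abs_torus_fun_simps2)
next
  fix x
  show "0 \<le> Re (ip_nu p x x)"
    by (cases x rule: torus_fun_cases) (simp add: ip_nu_self)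
  assume x: "x \<in> L2_nu p" "ip_nu p x x = 0"
  obtain f where f: "x = abs_torus_fun f" "f \<in> borel_measurable haar_torus" by (rule torus_fun_cases)
  have "integrable (nu_measure p) (\<lambda>x. (cmod (f x))\<^sup>2)" "(\<integral>x. (cmod (f x))\<^sup>2 \<partial>nu_measure p) = 0"
    using x f by (simp_all add: L2_nu_def abs_torus_fun_simps ip_nu_self)
  then have "AE x in nu_measure p. (cmod (f x))\<^sup>2 = 0"
    by (subst (asm) integral_nonneg_eq_0_iff_AE) auto
  \<comment> \<open>Equality in \<open>torus_fun\<close> is modulo Haar null sets; since
    \<open>p\<close> is non-zero, \<nu>-null sets are Haar null.\<close>
  then show "x = 0"
    using f AE_nu_measure_iff[OF p_nonzero] by (simp add: abs_torus_fun_simps)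
qed

sublocale L2: hilbert "ip_nu p" "L2_nu p"
proof
  show "L2.M.mcomplete"
    unfolding L2.M.mcomplete_def
  proof (intro allI impI)
    fix \<sigma> assume "L2.M.MCauchy \<sigma>"
    then have \<sigma>: "\<And>n. \<sigma> n \<in> L2_nu p"
      and cauchy: "\<And>\<epsilon>. \<epsilon> > 0 \<Longrightarrow> \<exists>N. \<forall>m n. N \<le> m \<longrightarrow> N \<le> n \<longrightarrow> ip_norm (ip_nu p) (\<sigma> m - \<sigma> n) < \<epsilon>"
      by (auto simp: L2.M.MCauchy_def ip_dist_def)
    have "\<forall>n. \<exists>f. \<sigma> n = abs_torus_fun f \<and> f \<in> borel_measurable haar_torus"
      by (metis torus_fun_cases)
    then obtain F where F: "\<And>n. \<sigma> n = abs_torus_fun (F n)" "\<And>n. F n \<in> borel_measurable haar_torus"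
      by metis
    obtain f where f: "f \<in> borel_measurable (nu_measure p)" "integrable (nu_measure p) (\<lambda>x. (cmod (f x))\<^sup>2)"
      "(\<lambda>n. \<integral>x. (cmod (F n x - f x))\<^sup>2 \<partial>nu_measure p) \<longlonglongrightarrow> 0"
    proof (rule nu.L2_complete[of F])
      show "F n \<in> borel_measurable (nu_measure p)" for n using F by simp
      show "integrable (nu_measure p) (\<lambda>x. (cmod (F n x))\<^sup>2)" for n
        using \<sigma>[of n] F by (simp add: L2_nu_def abs_torus_fun_simps)
      show "\<exists>N. \<forall>m\<ge>N. \<forall>n\<ge>N. (\<integral>x. (cmod (F m x - F n x))\<^sup>2 \<partial>nu_measure p) < \<epsilon>"
        if \<epsilon>: "\<epsilon> > 0" for \<epsilon>
      proof -
        \<comment> \<open>\<open>L2_complete\<close> measures squared norms, the Cauchy condition of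
          the metric plain ones.\<close>
        have "sqrt \<epsilon> > 0" using \<epsilon> by simp
        from cauchy[OF this] show ?thesis
          using F by (simp add: abs_torus_fun_simps2 ip_norm_nu)
      qed
    qed
    have "(\<lambda>n. ip_norm (ip_nu p) (\<sigma> n - abs_torus_fun f)) \<longlonglongrightarrow> 0"
      using tendsto_real_sqrt[OF f(3)] f(1) F by (simp add: abs_torus_fun_simps2 ip_norm_nu)
    moreover have "abs_torus_fun f \<in> L2_nu p" using f by (simp add: L2_nu_def abs_torus_fun_simps)
    ultimately show "\<exists>x. limitin L2.M.mtopology \<sigma> x sequentially"
      using \<sigma> by (auto simp: L2.limitin_iff)
  qed
qed

text \<open>Covers both coordinates at once. The factor has modulus 1 on the torus, which is the
  whole space of \<open>nu_measure p\<close>, so the integrands agree at every point of it.\<close>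

lemma unimodular_mult_isometry:
  assumes u [measurable]: "u \<in> borel_measurable haar_torus"
    and unimodular: "\<And>x. x \<in> sphere 0 1 \<times> sphere 0 1 \<Longrightarrow> cmod (u x) = 1"
    and T: "\<And>f. f \<in> borel_measurable haar_torus \<Longrightarrow> T (abs_torus_fun f) = abs_torus_fun (\<lambda>x. u x * f x)"
  shows "x \<in> L2_nu p \<Longrightarrow> T x \<in> L2_nu p" "ip_nu p (T x) (T y) = ip_nu p x y"
proof -
  obtain f where f: "x = abs_torus_fun f" and [measurable]: "f \<in> borel_measurable haar_torus"
    by (rule torus_fun_cases)
  obtain g where g: "y = abs_torus_fun g" and [measurable]: "g \<in> borel_measurable haar_torus"
    by (rule torus_fun_cases)
  have "integrable (nu_measure p) (\<lambda>x. (cmod (u x * f x))\<^sup>2) = integrable (nu_measure p) (\<lambda>x. (cmod (f x))\<^sup>2)"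
    by (rule Bochner_Integration.integrable_cong)
      (simp_all add: space_nu_measure norm_mult unimodular)
  then show "x \<in> L2_nu p \<Longrightarrow> T x \<in> L2_nu p"
    by (simp add: f T L2_nu_def abs_torus_fun_simps)
  have "u x * f x * cnj (u x * g x) = f x * cnj (g x)" if "x \<in> sphere 0 1 \<times> sphere 0 1" for x
  proof -
    have "u x * cnj (u x) = 1" using unimodular[OF that] complex_norm_square[of "u x"] by simp
    then show ?thesis by (simp add: mult_ac)
  qed
  then have "(\<integral>x. u x * f x * cnj (u x * g x) \<partial>nu_measure p) = (\<integral>x. f x * cnj (g x) \<partial>nu_measure p)"
    by (intro Bochner_Integration.integral_cong) (simp_all only: space_nu_measure)
  then show "ip_nu p (T x) (T y) = ip_nu p x y"
    by (simp add: f g T abs_torus_fun_simps2)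
qed

text \<open>A polynomial is continuous, hence bounded on the compact torus, and the measure is
  finite.\<close>

lemma range_torus_poly_L2: "range torus_poly \<subseteq> L2_nu p"
proof
  fix x assume "x \<in> range torus_poly"
  then obtain q where q: "x = torus_poly q" by blast
  have "continuous_on UNIV (\<lambda>x::complex \<times> complex. poly a (fst x))" for a :: "complex poly"
    by (intro continuous_intros)
  then have "continuous_on UNIV (\<lambda>x. poly (poly q [:snd x:]) (fst x))"
    by (induction q) (auto intro!: continuous_intros)
  then have "continuous_on (sphere 0 1 \<times> sphere 0 1) (bipoly_eval q)"
    unfolding bipoly_eval_def[abs_def] by (rule continuous_on_subset) simp
  then have "compact (bipoly_eval q ` (sphere 0 1 \<times> sphere 0 1))"
    by (intro compact_continuous_image compact_Times compact_sphere)
  then obtain B where "\<And>x. x \<in> sphere 0 1 \<times> sphere 0 1 \<Longrightarrow> cmod (bipoly_eval q x) \<le> B"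
    by (metis compact_imp_bounded bounded_iff imageI)
  then have "integrable (nu_measure p) (\<lambda>x. (cmod (bipoly_eval q x))\<^sup>2)"
    by (intro nu.integrable_const_bound[where B = "B\<^sup>2"] AE_I2)
      (auto intro!: power_mono simp: space_nu_measure)
  then show "x \<in> L2_nu p" by (simp add: q L2_nu_def torus_poly.abs_eq abs_torus_fun_simps)
qed

lemma H_space_eq: "H_space p = L2.M.mtopology closure_of (range torus_poly)"
  by (simp add: H_space_def L2.ip_topology_eq)

lemma closed_subspace_H_space: "closed_subspace (ip_nu p) (L2_nu p) (H_space p)"
  unfolding H_space_eq by (intro L2.closed_subspace_closure range_torus_poly_L2 subspace_range_torus_poly)

sublocale H: hilbert "ip_nu p" "H_space p"
  by (rule L2.hilbert_closed_subspace[OF closed_subspace_H_space])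

text \<open>Isometry is inherited from L^2(nu_p). Invariance of H_p is the point: it holds for the
  polynomials and passes to their closure.\<close>

lemma mult_isometry_H_space:
  assumes u: "u \<in> borel_measurable haar_torus"
    and unimodular: "\<And>x. x \<in> sphere 0 1 \<times> sphere 0 1 \<Longrightarrow> cmod (u x) = 1"
    and T: "\<And>f. f \<in> borel_measurable haar_torus \<Longrightarrow> T (abs_torus_fun f) = abs_torus_fun (\<lambda>x. u x * f x)"
    and linear: "\<And>x y. T (x + y) = T x + T y" "\<And>c x. T (c *\<^sub>C x) = c *\<^sub>C T x"
    and poly: "T ` range torus_poly \<subseteq> range torus_poly"
  shows "hilbert_isometry (ip_nu p) (H_space p) T"
proof
  note iso = unimodular_mult_isometry[OF u unimodular T]
  have "bounded_op (ip_nu p) (L2_nu p) T"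
    by (rule L2.bounded_opI[where K = 1]) (simp_all add: linear iso ip_norm_def)
  then have "T ` H_space p \<subseteq> H_space p"
    unfolding H_space_eq by (intro L2.bounded_op_closure range_torus_poly_L2 poly)
  then show "bounded_op (ip_nu p) (H_space p) T"
    by (intro H.bounded_opI[where K = 1]) (auto simp: linear iso ip_norm_def)
  show "ip_nu p (T x) (T y) = ip_nu p x y" for x y by (rule iso)
qed

sublocale Z: hilbert_isometry "ip_nu p" "H_space p" mult_z
  by (rule mult_isometry_H_space[of fst])
    (auto simp: abs_torus_fun_simps mult_z_linear torus_poly_linear)

sublocale W: hilbert_isometry "ip_nu p" "H_space p" mult_w
  by (rule mult_isometry_H_space[of snd])
    (auto simp: abs_torus_fun_simps mult_w_linear torus_poly_linear)

sublocale ZW: commuting_isometries "ip_nu p" "H_space p" mult_z mult_w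
  by unfold_locales (rule mult_z_w)

sublocale core: core_projections "ip_nu p" "H_space p" Z.defect W.defect ZW.joint_projection "core_op p"
proof unfold_locales
  show "core_op p x = Z.defect x + W.defect x - x + ZW.joint_projection x" for x
    by (simp add: core_op_def adj_z_def adj_w_def ZW.joint_projection_def Z.defect_def W.defect_def)
qed (simp_all add: Z.projection_defect W.projection_defect ZW.projection_joint ZW.defect_joint)

section \<open>Edge spaces, Gamma and its singular values\<close>

lemma E_z_eq: "E_z p = core.fixed_E"
  by (auto simp: E_z_def Z.in_ortho_range_iff core.fixed_E_def)

lemma E_w_iff: "x \<in> E_w p \<longleftrightarrow> x \<in> H_space p \<and> W.defect x = x"
  by (simp add: E_w_def W.in_ortho_range_iff)

lemma closed_subspace_E_z: "closed_subspace (ip_nu p) (H_space p) (E_z p)"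
  unfolding E_z_def by (rule Z.closed_subspace_ortho_range)

lemma Q_z_eq: "x \<in> H_space p \<Longrightarrow> Q_z p x = Z.defect x"
  by (simp add: Q_z_def E_z_def Z.ortho_proj_eq_defect)

lemma Q_w_eq: "x \<in> H_space p \<Longrightarrow> Q_w p x = W.defect x"
  by (simp add: Q_w_def E_w_def W.ortho_proj_eq_defect)

lemma Gamma_op_eq: "x \<in> E_z p \<Longrightarrow> Gamma_op p x = W.defect x"
  using Q_w_eq by (simp add: Gamma_op_def E_z_eq core.fixed_E_def)

text \<open>The adjoint is taken over the domain \<open>E_z p\<close>, so its values are compressed
  to that space, and compression to it is \<open>Z.defect\<close>.\<close>

lemma Gamma_adj_Gamma_op:
  assumes x: "x \<in> E_z p"
  shows "Gamma_adj p (Gamma_op p x) = Z.defect (W.defect x)"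
  unfolding Gamma_adj_def Gamma_op_eq[OF x]
proof (rule H.adjoint_on_eqI)
  have x': "x \<in> H_space p" using x by (simp add: E_z_eq core.fixed_E_def)
  show "Z.defect (W.defect x) \<in> E_z p"
    using x' by (simp add: E_z_eq core.fixed_E_def core.E_simps core.F_simps)
  show "ip_nu p (Gamma_op p v) (W.defect x) = ip_nu p v (Z.defect (W.defect x))" if v: "v \<in> E_z p" for v
  proof -
    have v': "v \<in> H_space p" "Z.defect v = v" using v by (auto simp: E_z_eq core.fixed_E_def)
    show ?thesis
      \<comment> \<open>With F the projection onto \<open>E_w p\<close> and E the one onto
        \<open>E_z p\<close>: <F v, F x> = <v, F x> = <E v, F x> = <v, E F x>.\<close>
      using v' x' H.projection_opD(2)[OF core.proj_E, of v "W.defect x"]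
        H.projection_opD(2)[OF core.proj_F, of v "W.defect x"]
      by (simp add: Gamma_op_eq[OF v] core.F_simps)
  qed
qed (use closed_subspace_E_z in \<open>auto simp: closed_subspace_def\<close>)

lemma singular_eigenspace:
  "eigenspace (E_z p) (adjoint_on (ip_nu p) (E_z p) (Gamma_op p) \<circ> Gamma_op p) (complex_of_real (s\<^sup>2))
    = {x \<in> core.fixed_E. Z.defect (W.defect x) = (complex_of_real s)\<^sup>2 *\<^sub>C x}"
  using Gamma_adj_Gamma_op by (auto simp: eigenspace_def E_z_eq[symmetric] Gamma_adj_def)

text \<open>Both signs are treated together because only \<mu>^2 enters the eigenvalue problem on
  the edge space. The range of \<open>s\<close> keeps \<mu> away from 0 and -1.\<close>

lemma eigenvalue_of_mult_iff_singular:
  assumes s: "0 < s" "s < 1" and \<mu>: "\<mu> = complex_of_real s \<or> \<mu> = - complex_of_real s"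
  shows "eigenvalue_of_mult (H_space p) (core_op p) \<mu> m \<longleftrightarrow>
    singular_value_of_mult (ip_nu p) (E_z p) (Gamma_op p) s m"
    "eigenspace (H_space p) (core_op p) \<mu> \<noteq> {0} \<longleftrightarrow> singular_value (ip_nu p) (E_z p) (Gamma_op p) s"
proof -
  have \<mu>': "\<mu> \<noteq> 0" "\<mu> \<noteq> -1" "\<mu>\<^sup>2 = (complex_of_real s)\<^sup>2"
    using s \<mu> by (auto simp: complex_eq_iff)
  show "eigenvalue_of_mult (H_space p) (core_op p) \<mu> m \<longleftrightarrow>
      singular_value_of_mult (ip_nu p) (E_z p) (Gamma_op p) s m"
    using s core.has_dim_eigenspace_C[OF \<mu>'(1,2), of m]
    unfolding eigenvalue_of_mult_def singular_value_of_mult_def singular_eigenspace \<mu>'(3) by simp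
  show "eigenspace (H_space p) (core_op p) \<mu> \<noteq> {0} \<longleftrightarrow> singular_value (ip_nu p) (E_z p) (Gamma_op p) s"
    using s core.eigenspace_C_nontrivial_iff[OF \<mu>'(1,2)]
    unfolding singular_value_def singular_eigenspace \<mu>'(3) by simp
qed

section \<open>Endpoint spaces and the non-zero spectrum\<close>

text \<open>Orthogonality to a sum of two subspaces is orthogonality to each, so the endpoint space
  is the intersection of the two edge spaces, that is, the common fixed space of the two
  defects.\<close>

lemma endpoint_plus_eq: "endpoint_plus p = eigenspace (H_space p) (core_op p) 1"
proof -
  let ?Z = "mult_z ` H_space p" and ?W = "mult_w ` H_space p"
  have "x \<in> endpoint_plus p \<longleftrightarrow> x \<in> E_z p \<and> x \<in> E_w p" for x
  proof
    assume x: "x \<in> endpoint_plus p"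
    \<comment> \<open>Zero in each range places both ranges inside the set of sums.\<close>
    have "0 \<in> ?Z" "0 \<in> ?W" by (auto simp: Z.in_range_iff W.in_range_iff core.E_simps(4) core.F_simps(4))
    then have "?Z \<subseteq> {f + g | f g. f \<in> ?Z \<and> g \<in> ?W}" "?W \<subseteq> {f + g | f g. f \<in> ?Z \<and> g \<in> ?W}"
      by force+
    then show "x \<in> E_z p \<and> x \<in> E_w p"
      using x ortho_minus_antimono unfolding endpoint_plus_def E_z_def E_w_def by blast
  next
    assume x: "x \<in> E_z p \<and> x \<in> E_w p"
    have "ip_nu p x (f + g) = 0" if "f \<in> ?Z" "g \<in> ?W" for f g
    proof -
      have "ip_nu p x f = 0" "ip_nu p x g = 0" "x \<in> H_space p" "f \<in> H_space p" "g \<in> H_space p"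
        using that x by (auto simp: E_z_def E_w_def ortho_minus_def Z.A_simps(1) W.A_simps(1))
      then show ?thesis by (simp add: H.ip_add_right)
    qed
    then show "x \<in> endpoint_plus p"
      using x by (auto simp: endpoint_plus_def E_z_def ortho_minus_def)
  qed
  then show ?thesis
    by (auto simp: core.eigenspace_C_1 E_z_eq core.fixed_E_def E_w_iff)
qed

text \<open>The complement of zw H_p is the fixed space of the defect of the product isometry, which
  is I minus the joint projection; z H_p and w H_p are the kernels of the two single
  defects.\<close>

lemma endpoint_minus_eq: "endpoint_minus p = eigenspace (H_space p) (core_op p) (-1)"
proof -
  interpret P: hilbert_isometry "ip_nu p" "H_space p" "\<lambda>x. mult_z (mult_w x)"
    by (rule ZW.product_isometry)
  have "P.defect x = x - ZW.joint_projection x" if "x \<in> H_space p" for x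
    using that by (simp add: P.defect_def ZW.product_adj ZW.joint_projection_def)
  then have "x \<in> endpoint_minus p \<longleftrightarrow>
      x \<in> H_space p \<and> Z.defect x = 0 \<and> W.defect x = 0 \<and> ZW.joint_projection x = 0" for x
    using P.in_ortho_range_iff[of x]
    by (auto simp: endpoint_minus_def ortho_minus_def Z.in_range_iff W.in_range_iff)
  then show ?thesis by (auto simp: core.eigenspace_C_minus_1)
qed

lemma op_spectrum_core:
  assumes "compact_op (ip_nu p) (H_space p) (core_op p)"
  shows "op_spectrum (ip_nu p) (H_space p) (core_op p) - {0} =
          {\<mu>. \<exists>s. 0 < s \<and> s < 1 \<and> singular_value (ip_nu p) (E_z p) (Gamma_op p) s \<and>
               (\<mu> = complex_of_real s \<or> \<mu> = - complex_of_real s)}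
          \<union> {\<mu>. \<mu> = 1 \<and> endpoint_plus p \<noteq> {0}}
          \<union> {\<mu>. \<mu> = -1 \<and> endpoint_minus p \<noteq> {0}}" (is "_ = ?R")
proof -
  let ?eig = "\<lambda>\<mu>. eigenspace (H_space p) (core_op p) \<mu> \<noteq> {0}"
  have "(\<mu> \<noteq> 0 \<and> ?eig \<mu>) \<longleftrightarrow> \<mu> \<in> ?R" for \<mu>
  proof
    assume \<mu>: "\<mu> \<noteq> 0 \<and> ?eig \<mu>"
    then obtain s where s: "\<mu> = complex_of_real s" "-1 \<le> s" "s \<le> 1"
      using core.C_eigenvalue_bounds[of \<mu>] by blast
    \<comment> \<open>Here \<mu> = s is real, non-zero and in [-1, 1]. A value strictly between -1
      and 0 is traced to the singular value \<open>- s\<close>.\<close>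
    consider "s = 1" | "s = -1" | "0 < s" "s < 1" | "0 < - s" "- s < 1" using s \<mu> by force
    then show "\<mu> \<in> ?R"
    proof cases
      case 3
      then have "singular_value (ip_nu p) (E_z p) (Gamma_op p) s"
        using eigenvalue_of_mult_iff_singular(2)[of s \<mu>] \<mu> s(1) by blast
      then show ?thesis using 3 s(1) by blast
    next
      case 4
      have "\<mu> = - complex_of_real (- s)" using s(1) by simp
      moreover from this have "singular_value (ip_nu p) (E_z p) (Gamma_op p) (- s)"
        using eigenvalue_of_mult_iff_singular(2)[of "- s" \<mu>] \<mu> 4 by blast
      ultimately show ?thesis using 4 by blast
    qed (use \<mu> s(1) in \<open>simp_all add: endpoint_plus_eq endpoint_minus_eq\<close>)
  next
    assume "\<mu> \<in> ?R"
    then show "\<mu> \<noteq> 0 \<and> ?eig \<mu>"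
      using eigenvalue_of_mult_iff_singular(2)[of _ \<mu>]
      by (auto simp: endpoint_plus_eq endpoint_minus_eq)
  qed
  note eq = this
  show ?thesis
    unfolding H.op_spectrum_compact_selfadjoint[OF assms core.selfadjoint_C[OF core.bounded_C]]
    by (rule set_eqI, subst eq[symmetric], rule mem_Collect_eq)
qed

end

theorem theorem10p3:
  fixes p :: "complex poly poly"
    and I :: "'i set" and e :: "'i \<Rightarrow> torus_fun"
    and J :: "'j set" and f :: "'j \<Rightarrow> torus_fun"
  assumes p_nonzero: "p \<noteq> 0"
  shows
    "reduces (ip_nu p) (H_space p) (core_op p \<circ> core_op p) (E_z p)
   \<and> (\<forall>x\<in>E_z p. core_op p (core_op p x) = Q_z p (Q_w p (Q_z p x))
              \<and> Q_z p (Q_w p (Q_z p x)) = Gamma_adj p (Gamma_op p x))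
   \<and> (orthonormal_basis (ip_nu p) (E_z p) I e \<and> orthonormal_basis (ip_nu p) (E_w p) J f \<longrightarrow>
        (\<forall>j\<in>J. \<forall>i\<in>I. op_matrix (ip_nu p) (Gamma_op p) e f j i = ip_nu p (e i) (f j)))
   \<and> (compact_op (ip_nu p) (H_space p) (core_op p) \<longrightarrow>
        (\<forall>s m. 0 < s \<and> s < 1 \<and> singular_value_of_mult (ip_nu p) (E_z p) (Gamma_op p) s m \<longrightarrow>
           eigenvalue_of_mult (H_space p) (core_op p) (complex_of_real s) m \<and>
           eigenvalue_of_mult (H_space p) (core_op p) (- complex_of_real s) m)
      \<and> eigenspace (H_space p) (core_op p) 1 = endpoint_plus p
      \<and> eigenspace (H_space p) (core_op p) (-1) = endpoint_minus p
      \<and> op_spectrum (ip_nu p) (H_space p) (core_op p) - {0} =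
          {\<mu>. \<exists>s. 0 < s \<and> s < 1 \<and> singular_value (ip_nu p) (E_z p) (Gamma_op p) s \<and>
               (\<mu> = complex_of_real s \<or> \<mu> = - complex_of_real s)}
          \<union> {\<mu>. \<mu> = 1 \<and> endpoint_plus p \<noteq> {0}}
          \<union> {\<mu>. \<mu> = -1 \<and> endpoint_minus p \<noteq> {0}}
      \<and> (\<forall>\<mu> \<in> op_spectrum (ip_nu p) (H_space p) (core_op p) - {0}.
           \<exists>m. eigenvalue_of_mult (H_space p) (core_op p) \<mu> m)
      \<and> (\<forall>s m. 0 < s \<and> s < 1 \<longrightarrow>
           (eigenvalue_of_mult (H_space p) (core_op p) (complex_of_real s) m \<longleftrightarrow>
              singular_value_of_mult (ip_nu p) (E_z p) (Gamma_op p) s m) \<and>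
           (eigenvalue_of_mult (H_space p) (core_op p) (- complex_of_real s) m \<longleftrightarrow>
              singular_value_of_mult (ip_nu p) (E_z p) (Gamma_op p) s m)))"
proof -
  interpret weighted_model p by unfold_locales (rule p_nonzero)
  have reduces: "reduces (ip_nu p) (H_space p) (core_op p \<circ> core_op p) (E_z p)"
    using core.reduces_C_C closed_subspace_E_z by (simp add: E_z_eq)
  have square: "core_op p (core_op p x) = Q_z p (Q_w p (Q_z p x))
      \<and> Q_z p (Q_w p (Q_z p x)) = Gamma_adj p (Gamma_op p x)" if "x \<in> E_z p" for x
    using that core.C_C_fixed_E[of x] Gamma_adj_Gamma_op[OF that]
    by (simp add: E_z_eq core.fixed_E_def Q_z_eq Q_w_eq core.F_simps(1))
  have matrix: "op_matrix (ip_nu p) (Gamma_op p) e f j i = ip_nu p (e i) (f j)"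
    if "orthonormal_basis (ip_nu p) (E_z p) I e" "orthonormal_basis (ip_nu p) (E_w p) J f" "j \<in> J" "i \<in> I"
    for i j
  proof -
    have e: "e i \<in> E_z p" and f: "f j \<in> E_w p" using that by (auto simp: orthonormal_basis_def)
    then show ?thesis
      \<comment> \<open>The projection in Gamma moves across the inner product onto
        \<open>f j\<close>, which it fixes.\<close>
      using H.projection_opD(2)[OF core.proj_F, of "e i" "f j"]
      by (simp add: op_matrix_def Gamma_op_eq E_w_iff E_z_eq core.fixed_E_def)
  qed
  have finite_mult: "\<exists>m. eigenvalue_of_mult (H_space p) (core_op p) \<mu> m"
    if compact: "compact_op (ip_nu p) (H_space p) (core_op p)"
      and \<mu>: "\<mu> \<in> op_spectrum (ip_nu p) (H_space p) (core_op p) - {0}" for \<mu>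
  proof -
    have \<mu>': "\<mu> \<noteq> 0" "eigenspace (H_space p) (core_op p) \<mu> \<noteq> {0}"
      using \<mu> H.op_spectrum_compact_selfadjoint[OF compact core.selfadjoint_C[OF core.bounded_C]] by auto
    obtain m where m: "has_dim (eigenspace (H_space p) (core_op p) \<mu>) m"
      using H.compact_op_eigenspace_has_dim[OF compact \<mu>'(1)] by blast
    then show ?thesis
      using has_dim_pos_iff[OF m] \<mu>'(2) by (auto simp: eigenvalue_of_mult_def)
  qed
  have mult: "eigenvalue_of_mult (H_space p) (core_op p) (complex_of_real s) m \<longleftrightarrow>
      singular_value_of_mult (ip_nu p) (E_z p) (Gamma_op p) s m"
    "eigenvalue_of_mult (H_space p) (core_op p) (- complex_of_real s) m \<longleftrightarrow>
      singular_value_of_mult (ip_nu p) (E_z p) (Gamma_op p) s m" if "0 < s" "s < 1" for s m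
    using eigenvalue_of_mult_iff_singular(1)[OF that] by blast+
  show ?thesis
    by (intro conjI impI allI ballI; (elim conjE)?;
        rule reduces square[THEN conjunct1] square[THEN conjunct2] matrix mult mult[THEN iffD2]
          endpoint_plus_eq[symmetric] endpoint_minus_eq[symmetric] op_spectrum_core finite_mult;
        assumption)
qed

end
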